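(* Suppose that $\mathbb{E}(\|Z\|^2) < \infty$, that $\Sigma := \mathbb{E}(Z Z^{\top})$ is positive definite, and that $\mathbb{E} Z = \mathbf{0}$. Then, for any compact convex set $K \subset \mathbb{R}^2$ containing the origin and with $\operatorname{diam} K = 1$, \[ \liminf_{n\to\infty} \rho_H\left(D_n^{-1}\mathcal{H}_n, K\right) = 0, \quad \text{almost surely}. \]
   Context: Let $Z, Z_1, Z_2, \ldots$ be i.i.d. random variables in $\mathbb{R}^2$ (viewed as column vectors), and let $S_0 := \mathbf{0}$ (the origin) and $S_n := \sum_{k=1}^n Z_k$ for $n \ge 1$. Let $\mathcal{H}_n$ be the convex hull of $\{S_0, \ldots, S_n\}$ and $D_n := \operatorname{diam}\mathcal{H}_n$. Here $\|\cdot\|$ is the Euclidean norm, and $\rho_H$ is the Hausdorff distance between non-empty compact subsets of $\mathbb{R}^2$: $\rho_H(K_1,K_2) = \inf\{\varepsilon \ge 0 : K_1 \subseteq K_2^{\varepsilon} \text{ and } K_2 \subseteq K_1^{\varepsilon}\}$, where $K^\varepsilon := \{\mathbf{x} \in \mathbb{R}^2 : \inf_{\mathbf{y}\in K}\|\mathbf{x}-\mathbf{y}\| \le \varepsilon\}$. Under the stated hypotheses $D_n > 0$ for all but finitely many $n$, a.s., so $D_n^{-1}\mathcal{H}_n = \{D_n^{-1}\mathbf{x} : \mathbf{x}\in\mathcal{H}_n\}$ is eventually well defined. *)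

theory Defs
  imports "HOL-Probability.Probability"
begin

definition walk :: "(nat \<Rightarrow> 'o \<Rightarrow> real^2) \<Rightarrow> nat \<Rightarrow> 'o \<Rightarrow> real^2"
  where "walk X n \<omega> = (\<Sum>k=1..n. X k \<omega>)"

definition walk_hull :: "(nat \<Rightarrow> 'o \<Rightarrow> real^2) \<Rightarrow> nat \<Rightarrow> 'o \<Rightarrow> (real^2) set"
  where "walk_hull X n \<omega> = convex hull ((\<lambda>k. walk X k \<omega>) ` {0..n})"

definition hull_diam :: "(nat \<Rightarrow> 'o \<Rightarrow> real^2) \<Rightarrow> nat \<Rightarrow> 'o \<Rightarrow> real"
  where "hull_diam X n \<omega> = diameter (walk_hull X n \<omega>)"

(* If the diameter is 0, then inverse 0 = 0 makes this the singleton of the origin. *)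
definition scaled_hull :: "(nat \<Rightarrow> 'o \<Rightarrow> real^2) \<Rightarrow> nat \<Rightarrow> 'o \<Rightarrow> (real^2) set"
  where "scaled_hull X n \<omega> =
    (\<lambda>x. inverse (hull_diam X n \<omega>) *\<^sub>R x) ` walk_hull X n \<omega>"

definition closed_nbhd :: "real \<Rightarrow> ('a::metric_space) set \<Rightarrow> 'a set"
  where "closed_nbhd \<epsilon> A = {x. infdist x A \<le> \<epsilon>}"

(* Meaningful for nonempty bounded sets: Inf on real is unspecified on the empty set,
   and infdist x {} = 0. *)
definition hausdorff_distance :: "('a::metric_space) set \<Rightarrow> 'a set \<Rightarrow> real"
  where "hausdorff_distance A B =
    Inf {\<epsilon>. 0 \<le> \<epsilon> \<and> A \<subseteq> closed_nbhd \<epsilon> B \<and> B \<subseteq> closed_nbhd \<epsilon> A}"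

(* columnvector leaves the number of (identical) columns free; the annotation fixes it to one. *)
definition outer_square :: "real^'n \<Rightarrow> real^'n^'n"
  where "outer_square z =
    (columnvector z :: real^1^'n) ** transpose (columnvector z :: real^1^'n)"

definition second_moment_matrix :: "'o measure \<Rightarrow> ('o \<Rightarrow> real^'n) \<Rightarrow> real^'n^'n"
  where "second_moment_matrix M Z = integral\<^sup>L M (\<lambda>\<omega>. outer_square (Z \<omega>))"

definition positive_definite :: "real^'n^'n \<Rightarrow> bool"
  where "positive_definite A \<longleftrightarrow>
    transpose A = A \<and> (\<forall>x. x \<noteq> 0 \<longrightarrow> 0 < x \<bullet> (A *v x))"

end

theory Submission
  imports Defs
begin

text \<open>
  Fix a compact convex \<open>K\<close> of diameter 1 that contains the origin, and an accuracy. At a suitable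
  scale \<open>R\<close> the walk traces out \<open>R\<close> times \<open>K\<close> with a probability bounded away from zero, however
  large \<open>R\<close> is. If the scales grow so fast that everything before a window of time is negligible on
  the scale of that window, then the convex hull at the end of a successful window is close to \<open>R\<close> times
  \<open>K\<close>. Its diameter is then close to \<open>R\<close>, so the normalised hull is close to \<open>K\<close>
  (\<open>block_hull_close\<close>). Successes in different windows are independent with probabilities bounded below,
  hence infinitely many windows succeed (\<open>infinitely_often_close\<close>).

  The heart is the lower bound for the probability that the walk follows a prescribed path
  (\<open>tracking\<close>). Donsker's theorem would give it; here it is derived from the one-dimensional central
  limit theorem. For each direction, a block of \<open>L\<close> steps moves the walk backwards along that direction by
  a multiple of \<open>sqrt L\<close> with probability bounded below (\<open>half_space_CLT\<close>), without
  long excursions (\<open>increment_maximal\<close>). A pigeonhole argument turns this into a specific displacement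
  \<open>w\<close> that is approximately made with probability bounded below (\<open>one_block\<close>). The
  displacement cannot be prescribed: all that is known is that it points backwards along a direction of
  one's choice. That suffices to follow a slow path within a bounded distance, always choosing the
  direction of the current error (\<open>steering\<close>). Since this distance is bounded independently of the path, it
  is relatively small for a sufficiently magnified copy of \<open>K\<close>.

  Everything except the passage from the second moment matrix to directional variances holds for a
  walk in an arbitrary Euclidean space.
\<close>

section \<open>Hausdorff distance and convex hulls\<close>

lemma closed_nbhdI:
  assumes "b \<in> B" "dist x b \<le> e"
  shows "x \<in> closed_nbhd e B"
  using assms by (auto simp: closed_nbhd_def intro: infdist_le2)

lemma hausdorff_distance_le:
  assumes "0 \<le> e" "A \<subseteq> closed_nbhd e B" "B \<subseteq> closed_nbhd e A"
  shows "hausdorff_distance A B \<le> e"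
  unfolding hausdorff_distance_def
  using assms by (intro cInf_lower bdd_belowI[of _ 0]) auto

text \<open>The infimum is over a nonempty set here, because the two sets are bounded.\<close>
lemma hausdorff_distance_nonneg:
  assumes "bounded A" "bounded B" "A \<noteq> {}" "B \<noteq> {}"
  shows "0 \<le> hausdorff_distance A B"
proof -
  obtain r where r: "\<And>x y. x \<in> A \<union> B \<Longrightarrow> y \<in> A \<union> B \<Longrightarrow> dist x y \<le> r"
    using assms bounded_two_points[of "A \<union> B"] by auto
  obtain a b where ab: "a \<in> A" "b \<in> B"
    using assms by auto
  have "0 \<le> r"
    using r[of a a] ab by simp
  moreover have "A \<subseteq> closed_nbhd r B" "B \<subseteq> closed_nbhd r A"
    using ab r by (auto intro!: closed_nbhdI)
  ultimately have "{\<epsilon>. 0 \<le> \<epsilon> \<and> A \<subseteq> closed_nbhd \<epsilon> B \<and> B \<subseteq> closed_nbhd \<epsilon> A} \<noteq> {}"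
    by blast
  then show ?thesis
    unfolding hausdorff_distance_def by (rule cInf_greatest) simp
qed

text \<open>If \<open>H\<close> is within \<open>e * R\<close> of \<open>R\<close> times \<open>K\<close>, its diameter differs from \<open>R\<close> by at most
\<open>2 * e * R\<close>. Since \<open>H\<close> contains the origin, its points have norm at most its diameter, so
dividing by the diameter instead of \<open>R\<close> moves them by at most \<open>2 * e\<close>.\<close>
lemma hausdorff_distance_normalized:
  fixes H K :: "'a::euclidean_space set"
  assumes "compact H" "0 \<in> H" "compact K" "0 \<in> K" "diameter K = 1"
    and "R > 0" "0 \<le> e" "e < 1/2"
    and HK: "\<And>h. h \<in> H \<Longrightarrow> \<exists>k\<in>K. norm (h - R *\<^sub>R k) \<le> e * R"
    and KH: "\<And>k. k \<in> K \<Longrightarrow> \<exists>h\<in>H. norm (h - R *\<^sub>R k) \<le> e * R"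
  shows "hausdorff_distance ((\<lambda>x. inverse (diameter H) *\<^sub>R x) ` H) K \<le> 3 * e"
proof -
  define D where "D = diameter H"
  have bounded: "bounded H" "bounded K"
    using assms by (auto intro: compact_imp_bounded)
  have upper: "D \<le> R + 2 * (e * R)"
    unfolding D_def
  proof (rule diameter_le)
    fix x y assume "x \<in> H" "y \<in> H"
    then obtain k l where kl: "k \<in> K" "l \<in> K" "norm (x - R *\<^sub>R k) \<le> e * R" "norm (y - R *\<^sub>R l) \<le> e * R"
      using HK by meson
    have "norm (k - l) \<le> 1"
      using diameter_bounded_bound[OF bounded(2) kl(1,2)] assms by (simp add: dist_norm)
    then have "norm (R *\<^sub>R (k - l)) \<le> R"
      using \<open>R > 0\<close> by simp
    moreover have "norm (x - y) = norm ((x - R *\<^sub>R k) - (y - R *\<^sub>R l) + R *\<^sub>R (k - l))"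
      by (simp add: algebra_simps)
    ultimately show "norm (x - y) \<le> R + 2 * (e * R)"
      using kl norm_triangle_ineq[of "(x - R *\<^sub>R k) - (y - R *\<^sub>R l)" "R *\<^sub>R (k - l)"]
        norm_triangle_ineq4[of "x - R *\<^sub>R k" "y - R *\<^sub>R l"] by linarith
  qed (use assms in auto)
  have lower: "R - 2 * (e * R) \<le> D"
  proof -
    obtain k l where k: "k \<in> K" "l \<in> K" "dist k l = 1"
      using diameter_compact_attained[of K] assms by auto
    obtain x y where xy: "x \<in> H" "y \<in> H" "norm (x - R *\<^sub>R k) \<le> e * R" "norm (y - R *\<^sub>R l) \<le> e * R"
      using KH k by meson
    have "norm (R *\<^sub>R (k - l)) = R"
      using k \<open>R > 0\<close> by (simp add: dist_norm)
    moreover have "norm (R *\<^sub>R (k - l)) = norm ((x - y) - ((x - R *\<^sub>R k) - (y - R *\<^sub>R l)))"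
      by (simp add: algebra_simps)
    ultimately have "R \<le> norm (x - y) + 2 * (e * R)"
      using xy norm_triangle_ineq4[of "x - y" "(x - R *\<^sub>R k) - (y - R *\<^sub>R l)"]
        norm_triangle_ineq4[of "x - R *\<^sub>R k" "y - R *\<^sub>R l"] by linarith
    then show ?thesis
      using diameter_bounded_bound[OF bounded(1) xy(1,2)] by (simp add: D_def dist_norm)
  qed
  have "e * R < 1/2 * R"
    using assms by (intro mult_strict_right_mono) auto
  then have D: "D > 0"
    using lower by linarith
  have close: "dist (inverse D *\<^sub>R h) k \<le> 3 * e"
    if "h \<in> H" "norm (h - R *\<^sub>R k) \<le> e * R" for h k
  proof -
    have "norm h \<le> D"
      using diameter_bounded_bound[OF bounded(1) that(1) \<open>0 \<in> H\<close>] by (simp add: D_def)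
    have "inverse D - inverse R = (R - D) / (D * R)"
      using D \<open>R > 0\<close> by (simp add: field_simps)
    then have "norm ((inverse D - inverse R) *\<^sub>R h) = \<bar>R - D\<bar> / R * (norm h / D)"
      using D \<open>R > 0\<close> by (simp add: abs_mult)
    also have "\<dots> \<le> \<bar>R - D\<bar> / R * 1"
      using \<open>norm h \<le> D\<close> D \<open>R > 0\<close> by (intro mult_left_mono) auto
    also have "\<dots> \<le> 2 * e"
      using upper lower \<open>R > 0\<close> by (simp add: field_simps abs_le_iff)
    finally have "norm ((inverse D - inverse R) *\<^sub>R h) \<le> 2 * e" .
    moreover have "norm (inverse R *\<^sub>R (h - R *\<^sub>R k)) \<le> e"
      using that(2) \<open>R > 0\<close> unfolding norm_scaleR by (simp add: field_simps)
    moreover have "norm (inverse D *\<^sub>R h - k)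
        = norm ((inverse D - inverse R) *\<^sub>R h + inverse R *\<^sub>R (h - R *\<^sub>R k))"
      using \<open>R > 0\<close> by (simp add: algebra_simps)
    ultimately show ?thesis
      unfolding dist_norm
      using norm_triangle_ineq[of "(inverse D - inverse R) *\<^sub>R h" "inverse R *\<^sub>R (h - R *\<^sub>R k)"]
      by linarith
  qed
  show ?thesis
    unfolding D_def[symmetric]
  proof (rule hausdorff_distance_le)
    show "(*\<^sub>R) (inverse D) ` H \<subseteq> closed_nbhd (3 * e) K"
    proof safe
      fix h assume h: "h \<in> H"
      with HK obtain k where "k \<in> K" "norm (h - R *\<^sub>R k) \<le> e * R"
        by blast
      with h show "inverse D *\<^sub>R h \<in> closed_nbhd (3 * e) K"
        by (intro closed_nbhdI[of k] close)
    qed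
    show "K \<subseteq> closed_nbhd (3 * e) ((*\<^sub>R) (inverse D) ` H)"
    proof
      fix k assume "k \<in> K"
      with KH obtain h where h: "h \<in> H" "norm (h - R *\<^sub>R k) \<le> e * R"
        by blast
      then show "k \<in> closed_nbhd (3 * e) ((*\<^sub>R) (inverse D) ` H)"
        by (intro closed_nbhdI[of "inverse D *\<^sub>R h"]) (auto simp: dist_commute[of k] intro: close)
    qed
  qed (use assms in simp)
qed

text \<open>The set of points within \<open>r\<close> of a convex set is convex, being a Minkowski sum with a ball.\<close>
lemma convex_hull_near_convex:
  fixes K S :: "'a::euclidean_space set"
  assumes "convex K" and S: "\<And>x. x \<in> S \<Longrightarrow> \<exists>k\<in>K. norm (x - R *\<^sub>R k) \<le> r"
    and "h \<in> convex hull S"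
  shows "\<exists>k\<in>K. norm (h - R *\<^sub>R k) \<le> r"
proof -
  let ?N = "\<Union>x\<in>(*\<^sub>R) R ` K. \<Union>y\<in>cball 0 r. {x + y}"
  have mem: "x \<in> ?N \<longleftrightarrow> (\<exists>k\<in>K. norm (x - R *\<^sub>R k) \<le> r)" for x
  proof
    assume "\<exists>k\<in>K. norm (x - R *\<^sub>R k) \<le> r"
    then obtain k where "k \<in> K" "norm (x - R *\<^sub>R k) \<le> r"
      by blast
    then show "x \<in> ?N"
      by (auto intro!: bexI[of _ "x - R *\<^sub>R k" "cball 0 r"] bexI[of _ k K])
  next
    assume "x \<in> ?N"
    then obtain k y where "k \<in> K" "norm y \<le> r" "x = R *\<^sub>R k + y"
      by auto
    then show "\<exists>k\<in>K. norm (x - R *\<^sub>R k) \<le> r"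
      by (intro bexI[of _ k]) auto
  qed
  have "convex ?N"
    by (intro convex_sums convex_scaling assms convex_cball)
  moreover have "S \<subseteq> ?N"
    using S mem by blast
  ultimately have "convex hull S \<subseteq> ?N"
    by (intro hull_minimal)
  then show ?thesis
    using assms(3) mem by blast
qed

text \<open>A path in \<open>K\<close> with short steps through all points of \<open>V\<close>: it goes from the origin straight to
each of them and back, which stays in \<open>K\<close> by convexity. Ending at the origin lets the next excursion
be appended in the induction.\<close>
lemma dense_path:
  fixes K :: "'a::real_normed_vector set"
  assumes "convex K" "0 \<in> K" "finite V" "V \<subseteq> K" and \<eta>: "\<eta> > 0"
  shows "\<exists>m u. m > 0 \<and> u 0 = 0 \<and> (\<forall>i. u i \<in> K) \<and> (\<forall>i. norm (u (Suc i) - u i) \<le> \<eta>)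
    \<and> V \<subseteq> u ` {..<m} \<and> (\<forall>i\<ge>m. u i = 0)"
  using assms(3,4)
proof (induction V rule: finite_induct)
  case empty
  show ?case
    using assms by (intro exI[of _ 1] exI[of _ "\<lambda>_. 0"]) auto
next
  case (insert w V)
  then obtain m u where IH: "m > 0" "u 0 = 0" "\<And>i. u i \<in> K" "\<And>i. norm (u (Suc i) - u i) \<le> \<eta>"
    "V \<subseteq> u ` {..<m}" "\<And>i. i \<ge> m \<Longrightarrow> u i = 0"
    by auto
  define n where "n = nat \<lceil>norm w / \<eta>\<rceil> + 1"
  have n: "n > 0" "norm w / n \<le> \<eta>"
  proof -
    have "norm w / \<eta> \<le> n"
      unfolding n_def by linarith
    moreover show "n > 0"
      by (simp add: n_def)
    ultimately show "norm w / n \<le> \<eta>"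
      using \<eta> by (simp add: pos_divide_le_eq mult.commute)
  qed
  \<comment> \<open>The tent function: up from 0 to 1 in \<open>n\<close> steps, and down again.\<close>
  define t where "t i = max 0 (1 - \<bar>real i - n\<bar> / n)" for i :: nat
  have t: "t 0 = 0" "t n = 1" "0 \<le> t i" "t i \<le> 1" "i \<ge> 2 * n \<Longrightarrow> t i = 0" for i
    using n by (auto simp: t_def field_simps)
  have t_step: "\<bar>t (Suc i) - t i\<bar> \<le> 1 / n" for i
  proof -
    have "\<bar>t (Suc i) - t i\<bar> \<le> \<bar>\<bar>real i - n\<bar> / n - \<bar>real (Suc i) - n\<bar> / n\<bar>"
      unfolding t_def by linarith
    also have "\<dots> = \<bar>\<bar>real i - n\<bar> - \<bar>real (Suc i) - n\<bar>\<bar> / n"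
      by (simp flip: diff_divide_distrib)
    also have "\<dots> \<le> 1 / n"
      by (intro divide_right_mono) auto
    finally show ?thesis .
  qed
  define u' where "u' i = (if i < m then u i else t (i - m) *\<^sub>R w)" for i
  have "u' (Suc i) \<in> K" "u' i \<in> K" for i
  proof -
    have "t j *\<^sub>R w \<in> K" for j
      using convexD[OF \<open>convex K\<close> \<open>0 \<in> K\<close>, of w "1 - t j" "t j"] insert t by simp
    then show "u' i \<in> K" "u' (Suc i) \<in> K"
      using IH by (auto simp: u'_def)
  qed
  moreover have "norm (u' (Suc i) - u' i) \<le> \<eta>" for i
  proof (cases "i < m")
    case True
    then have "u' (Suc i) = u (Suc i)" "u' i = u i"
      using IH(6)[of "Suc i"] t(1) by (cases "Suc i = m"; simp add: u'_def)+
    then show ?thesis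
      using IH by simp
  next
    case False
    then have "u' (Suc i) - u' i = (t (Suc (i - m)) - t (i - m)) *\<^sub>R w"
      by (simp add: u'_def Suc_diff_le scaleR_diff_left)
    then have "norm (u' (Suc i) - u' i) \<le> 1 / n * norm w"
      using t_step[of "i - m"] by (simp add: mult_right_mono del: times_divide_eq_left)
    then show ?thesis
      using n by simp
  qed
  moreover have "insert w V \<subseteq> u' ` {..<m + 2 * n}"
  proof -
    have "w = u' (m + n)"
      by (simp add: u'_def t)
    then have "w \<in> u' ` {..<m + 2 * n}"
      using n by auto
    moreover have "u ` {..<m} = u' ` {..<m}"
      by (auto simp: u'_def)
    ultimately show ?thesis
      using IH(5) by auto
  qed
  moreover have "u' 0 = 0" "\<forall>i\<ge>m + 2 * n. u' i = 0"
    using IH t by (auto simp: u'_def)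
  ultimately show ?case
    using IH(1) by (intro exI[of _ "m + 2 * n"] exI[of _ u']) auto
qed

section \<open>Increments of a sequence\<close>

definition increment :: "(nat \<Rightarrow> 'e::comm_monoid_add) \<Rightarrow> nat \<Rightarrow> nat \<Rightarrow> 'e"
  where "increment f s n = (\<Sum>i<n. f (s + i))"

lemma increment_0 [simp]: "increment f s 0 = 0"
  by (simp add: increment_def)

lemma increment_add: "increment f s (m + n) = increment f s m + increment f (s + m) n"
  by (induction n) (simp_all add: increment_def add.assoc)

lemma increment_shift: "increment (\<lambda>i. f (s + i)) r n = increment f (s + r) n"
  by (simp add: increment_def add.assoc)

lemma increment_cong:
  assumes "\<And>i. s \<le> i \<Longrightarrow> i < s + n \<Longrightarrow> f i = g i"
  shows "increment f s n = increment g s n"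
  unfolding increment_def by (intro sum.cong) (auto simp: assms)

lemma measurable_increment [measurable]:
  "(\<lambda>f. increment f s n) \<in>
    borel_measurable (Pi\<^sub>M UNIV (\<lambda>_::nat. borel :: 'e::euclidean_space measure))"
  unfolding increment_def by measurable

text \<open>The hull is close to \<open>R\<close> times \<open>K\<close> if the walk up to time \<open>s\<close> stays near the origin and
from then on follows a path through a net of \<open>K\<close>. With error \<open>\<epsilon> * R\<close> each for the past, the
tracking and the net, the hull is \<open>3 * \<epsilon> * R\<close>-close.\<close>
lemma block_hull_close:
  fixes K :: "'e::euclidean_space set"
  assumes K: "compact K" "convex K" "0 \<in> K" "diameter K = 1"
    and net: "K \<subseteq> (\<Union>i<m. ball (u i) \<epsilon>)" "\<And>i. u i \<in> K"
    and \<epsilon>: "0 < \<epsilon>" "\<epsilon> < 1/6" and "R > 0"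
    and past: "\<And>j. j \<le> s \<Longrightarrow> norm (increment f 0 j) \<le> \<epsilon> * R"
    and block: "\<And>i j. i < m \<Longrightarrow> j \<le> L \<Longrightarrow> norm (increment f s (i * L + j) - R *\<^sub>R u i) \<le> \<epsilon> * R"
  defines "H \<equiv> convex hull ((\<lambda>k. increment f 0 k) ` {0..s + m * L})"
  shows "hausdorff_distance ((\<lambda>x. inverse (diameter H) *\<^sub>R x) ` H) K \<le> 9 * \<epsilon>"
proof -
  have new: "norm (increment f 0 (s + (i * L + j)) - R *\<^sub>R u i) \<le> 2 * (\<epsilon> * R)"
    if "i < m" "j \<le> L" for i j
  proof -
    have "increment f 0 (s + (i * L + j)) - R *\<^sub>R u i
        = increment f 0 s + (increment f s (i * L + j) - R *\<^sub>R u i)"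
      by (simp add: increment_add[of f 0 s])
    then show ?thesis
      using norm_triangle_ineq[of "increment f 0 s" "increment f s (i * L + j) - R *\<^sub>R u i"]
        past[OF order_refl] block[OF that] by (simp only: mult_2)
  qed
  have "hausdorff_distance ((\<lambda>x. inverse (diameter H) *\<^sub>R x) ` H) K \<le> 3 * (3 * \<epsilon>)"
  proof (rule hausdorff_distance_normalized)
    show "compact H"
      unfolding H_def by (intro finite_imp_compact_convex_hull) simp
    have "increment f 0 0 \<in> H"
      unfolding H_def by (rule hull_inc) (rule imageI, simp)
    then show "0 \<in> H"
      by simp
  next
    fix h assume "h \<in> H"
    show "\<exists>k\<in>K. norm (h - R *\<^sub>R k) \<le> 3 * \<epsilon> * R"
    proof (rule convex_hull_near_convex[OF K(2)])
      show "h \<in> convex hull ((\<lambda>k. increment f 0 k) ` {0..s + m * L})"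
        using \<open>h \<in> H\<close> by (simp add: H_def)
    next
      fix x assume "x \<in> (\<lambda>k. increment f 0 k) ` {0..s + m * L}"
      then obtain n where n: "n \<le> s + m * L" "x = increment f 0 n"
        by auto
      show "\<exists>k\<in>K. norm (x - R *\<^sub>R k) \<le> 3 * \<epsilon> * R"
      proof (cases "n \<le> s")
        case True
        have "\<epsilon> * R > 0"
          using \<epsilon> \<open>R > 0\<close> by simp
        then show ?thesis
          using past[OF True] K(3) n by (intro bexI[of _ 0]) auto
      next
        case False
        \<comment> \<open>Shifting by one puts the last time of a block, including the time \<open>s + m * L\<close>, into that
          block instead of the next one.\<close>
        define t where "t = n - s - 1"
        have t: "n = s + Suc t" "t < m * L"
          using False n by (auto simp: t_def)
        then have "L > 0"
          by (cases L) auto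
        have "t div L < m"
          using t(2) by (simp add: less_mult_imp_div_less)
        moreover have "Suc (t mod L) \<le> L"
          using \<open>L > 0\<close> by (simp add: Suc_leI)
        moreover have "n = s + (t div L * L + Suc (t mod L))"
          using t by simp
        ultimately have "norm (x - R *\<^sub>R u (t div L)) \<le> 2 * (\<epsilon> * R)"
          using new n(2) by metis
        moreover have "2 * (\<epsilon> * R) \<le> 3 * \<epsilon> * R"
          using \<epsilon> \<open>R > 0\<close> by simp
        ultimately have "norm (x - R *\<^sub>R u (t div L)) \<le> 3 * \<epsilon> * R"
          by (rule order_trans)
        then show ?thesis
          using net(2) by blast
      qed
    qed
  next
    fix k assume "k \<in> K"
    then obtain i where i: "i < m" "norm (u i - k) < \<epsilon>"
      using net(1) by (auto simp: dist_norm)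
    let ?h = "increment f 0 (s + (i * L + 0))"
    have "?h \<in> H"
      unfolding H_def using i by (intro hull_inc imageI) (simp add: mult_le_mono1)
    moreover have "norm (?h - R *\<^sub>R k) \<le> 3 * \<epsilon> * R"
    proof -
      have "norm (R *\<^sub>R (u i - k)) \<le> \<epsilon> * R"
        using i(2) \<open>R > 0\<close> by (simp add: mult.commute)
      moreover have "norm (?h - R *\<^sub>R k) = norm ((?h - R *\<^sub>R u i) + R *\<^sub>R (u i - k))"
        by (simp add: algebra_simps)
      ultimately show ?thesis
        using new[OF i(1), of 0] norm_triangle_ineq[of "?h - R *\<^sub>R u i" "R *\<^sub>R (u i - k)"]
        by linarith
    qed
    ultimately show "\<exists>h\<in>H. norm (h - R *\<^sub>R k) \<le> 3 * \<epsilon> * R"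
      by blast
  qed (use K \<epsilon> \<open>R > 0\<close> in auto)
  then show ?thesis
    by simp
qed

section \<open>Random walks with finite variance\<close>

text \<open>Nondegeneracy is stated as a uniform lower bound \<open>v\<close> on the variance in every direction, which
is what the half-space estimate below consumes.\<close>
locale iid_walk = prob_space M for M :: "'o measure" +
  fixes Y :: "nat \<Rightarrow> 'o \<Rightarrow> 'e::euclidean_space" and v :: real
  assumes indep: "indep_vars (\<lambda>_. borel) Y UNIV"
    and ident: "distr M borel (Y i) = distr M borel (Y 0)"
    and square_integrable: "integrable M (\<lambda>\<omega>. (norm (Y 0 \<omega>))\<^sup>2)"
    and centred: "expectation (Y 0) = 0"
    and v_pos: "v > 0"
    and nondegenerate: "v * (norm \<theta>)\<^sup>2 \<le> expectation (\<lambda>\<omega>. (\<theta> \<bullet> Y 0 \<omega>)\<^sup>2)"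
begin

abbreviation steps :: "'o \<Rightarrow> nat \<Rightarrow> 'e"
  where "steps \<omega> \<equiv> \<lambda>i. Y i \<omega>"

lemma measurable_Y [measurable]: "Y i \<in> borel_measurable M"
  using indep by (auto simp: indep_vars_def2)

lemma measurable_steps [measurable]: "steps \<in> measurable M (Pi\<^sub>M UNIV (\<lambda>_. borel))"
  by (rule measurable_PiM_single') (auto simp: space_PiM)

lemma measurable_increment_steps [measurable]:
  "(\<lambda>\<omega>. increment (steps \<omega>) s n) \<in> borel_measurable M"
  unfolding increment_def by measurable

text \<open>Both sides are values of one product measure: a shift of an i.i.d. sequence has the same law.\<close>
lemma steps_stationary:
  assumes P: "Measurable.pred (Pi\<^sub>M UNIV (\<lambda>_. borel)) P"
  shows "prob {\<omega> \<in> space M. P (\<lambda>i. Y (s + i) \<omega>)} = prob {\<omega> \<in> space M. P (steps \<omega>)}"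
proof -
  have shifted: "distr M (Pi\<^sub>M UNIV (\<lambda>_. borel)) (\<lambda>\<omega> i. Y (r + i) \<omega>)
      = Pi\<^sub>M UNIV (\<lambda>_. distr M borel (Y 0))" for r
  proof -
    have "indep_vars (\<lambda>j. Pi\<^sub>M {r + j} (\<lambda>_. borel)) (\<lambda>j \<omega>. restrict (steps \<omega>) {r + j}) UNIV"
      by (rule indep_vars_restrict[OF indep]) (auto simp: disjoint_family_on_def)
    then have "indep_vars (\<lambda>_. borel) (\<lambda>j \<omega>. (restrict (steps \<omega>) {r + j}) (r + j)) UNIV"
      by (rule indep_vars_compose2[where Y = "\<lambda>j f. f (r + j)"]) auto
    then have "indep_vars (\<lambda>_. borel) (\<lambda>j. Y (r + j)) UNIV"
      by simp
    then have "distr M (Pi\<^sub>M UNIV (\<lambda>_. borel)) (\<lambda>\<omega>. \<lambda>i\<in>UNIV. Y (r + i) \<omega>)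
        = Pi\<^sub>M UNIV (\<lambda>i. distr M borel (Y (r + i)))"
      by (subst (asm) indep_vars_iff_distr_eq_PiM) auto
    moreover have "(\<lambda>i. distr M borel (Y (r + i))) = (\<lambda>_. distr M borel (Y 0))"
      by (rule ext) (rule ident)
    ultimately show ?thesis
      by (simp add: restrict_def)
  qed
  have "prob {\<omega> \<in> space M. P (\<lambda>i. Y (r + i) \<omega>)}
      = measure (Pi\<^sub>M UNIV (\<lambda>_. distr M borel (Y 0))) {f. P f}" for r
  proof -
    have [measurable]: "(\<lambda>\<omega> i. Y (r + i) \<omega>) \<in> measurable M (Pi\<^sub>M UNIV (\<lambda>_. borel))"
      by (rule measurable_PiM_single') (auto simp: space_PiM)
    have "{f. P f} \<in> sets (Pi\<^sub>M UNIV (\<lambda>_. borel))"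
      using P by (simp add: pred_def space_PiM)
    then show ?thesis
      unfolding shifted[of r, symmetric]
      by (subst measure_distr) (auto intro!: arg_cong[where f = prob])
  qed
  from this[of s] this[of 0] show ?thesis
    by simp
qed

text \<open>Locality of \<open>P j\<close> (it looks only at the coordinates in \<open>K j\<close>) lets the predicate factor through
the restriction of the sequence to \<open>K j\<close>, and such restrictions to disjoint sets are independent.\<close>
lemma indep_events_blocks:
  assumes "disjoint_family_on K J"
    and P: "\<And>j. j \<in> J \<Longrightarrow> Measurable.pred (Pi\<^sub>M UNIV (\<lambda>_. borel)) (P j)"
    and local: "\<And>j f g. j \<in> J \<Longrightarrow> (\<And>i. i \<in> K j \<Longrightarrow> f i = g i) \<Longrightarrow> P j f \<Longrightarrow> P j g"
  shows "indep_events (\<lambda>j. {\<omega> \<in> space M. P j (steps \<omega>)}) J"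
proof -
  \<comment> \<open>Outside \<open>K j\<close> any filler does, by locality; zero is a measurable choice.\<close>
  define ext where "ext j f = (\<lambda>i. if i \<in> K j then f i else 0)" for j and f :: "nat \<Rightarrow> 'e"
  have ext: "ext j \<in> measurable (Pi\<^sub>M (K j) (\<lambda>_. borel)) (Pi\<^sub>M UNIV (\<lambda>_. borel))" for j
    unfolding ext_def
  proof (rule measurable_PiM_single')
    show "(\<lambda>f. if i \<in> K j then f i else 0) \<in> borel_measurable (Pi\<^sub>M (K j) (\<lambda>_. borel))" for i
      by (cases "i \<in> K j") auto
  qed (auto simp: space_PiM)
  have "indep_vars (\<lambda>j. Pi\<^sub>M (K j) (\<lambda>_. borel)) (\<lambda>j \<omega>. restrict (steps \<omega>) (K j)) J"
    by (rule indep_vars_restrict[OF indep]) (use assms(1) in auto)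
  then have "indep_events
      (\<lambda>j. {\<omega> \<in> space M. P j (ext j (restrict (steps \<omega>) (K j)))}) J"
  proof (rule indep_eventsI_indep_vars)
    fix j assume "j \<in> J"
    from P[OF this] ext[of j] have "Measurable.pred (Pi\<^sub>M (K j) (\<lambda>_. borel)) (\<lambda>f. P j (ext j f))"
      by (rule measurable_compose[rotated])
    then show "{f \<in> space (Pi\<^sub>M (K j) (\<lambda>_. borel)). P j (ext j f)} \<in> sets (Pi\<^sub>M (K j) (\<lambda>_. borel))"
      by (simp add: pred_def)
  qed
  moreover have "P j (ext j (restrict (steps \<omega>) (K j))) \<longleftrightarrow> P j (steps \<omega>)" if "j \<in> J" for j \<omega>
    using local[OF that, of "ext j (restrict (steps \<omega>) (K j))" "steps \<omega>"]
      local[OF that, of "steps \<omega>" "ext j (restrict (steps \<omega>) (K j))"]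
    by (auto simp: ext_def)
  ultimately show ?thesis
    unfolding indep_events_def_alt
    by (subst indep_sets_cong) auto
qed

abbreviation total_variance :: real
  where "total_variance \<equiv> expectation (\<lambda>\<omega>. (norm (Y 0 \<omega>))\<^sup>2)"

lemma transfer_to_first_step:
  assumes "f \<in> borel_measurable borel"
  shows "integrable M (\<lambda>\<omega>. f (Y i \<omega>)) \<longleftrightarrow> integrable M (\<lambda>\<omega>. f (Y 0 \<omega>))"
    and "expectation (\<lambda>\<omega>. f (Y i \<omega>)) = expectation (\<lambda>\<omega>. f (Y 0 \<omega>) :: 'b::{banach, second_countable_topology})"
  using integrable_distr_eq[of "Y i" M borel f] integrable_distr_eq[of "Y 0" M borel f]
    integral_distr[of "Y i" M borel f] integral_distr[of "Y 0" M borel f] assms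
  by (simp_all add: ident[of i])

lemma square_integrable_inner: "integrable M (\<lambda>\<omega>. (\<theta> \<bullet> Y i \<omega>)\<^sup>2)"
proof -
  have "integrable M (\<lambda>\<omega>. (\<theta> \<bullet> Y 0 \<omega>)\<^sup>2)"
  proof (rule Bochner_Integration.integrable_bound)
    show "integrable M (\<lambda>\<omega>. (norm \<theta>)\<^sup>2 * (norm (Y 0 \<omega>))\<^sup>2)"
      using square_integrable by simp
    show "AE \<omega> in M. norm ((\<theta> \<bullet> Y 0 \<omega>)\<^sup>2) \<le> norm ((norm \<theta>)\<^sup>2 * (norm (Y 0 \<omega>))\<^sup>2)"
    proof (intro AE_I2)
      fix \<omega>
      have "\<bar>\<theta> \<bullet> Y 0 \<omega>\<bar>\<^sup>2 \<le> (norm \<theta> * norm (Y 0 \<omega>))\<^sup>2"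
        by (rule power_mono[OF Cauchy_Schwarz_ineq2]) simp
      then show "norm ((\<theta> \<bullet> Y 0 \<omega>)\<^sup>2) \<le> norm ((norm \<theta>)\<^sup>2 * (norm (Y 0 \<omega>))\<^sup>2)"
        by (simp add: power_mult_distrib)
    qed
  qed measurable
  then show ?thesis
    using transfer_to_first_step(1)[of "\<lambda>y. (\<theta> \<bullet> y)\<^sup>2" i] by simp
qed

lemma integrable_Y: "integrable M (Y i)"
proof -
  have "integrable M (\<lambda>\<omega>. norm (Y 0 \<omega>))"
    by (rule square_integrable_imp_integrable) (use square_integrable in auto)
  then have "integrable M (Y 0)"
    by (subst (asm) integrable_norm_iff) auto
  then show ?thesis
    using transfer_to_first_step(1)[of "\<lambda>y. y" i] by simp
qed

lemma expectation_inner: "expectation (\<lambda>\<omega>. \<theta> \<bullet> Y i \<omega>) = 0"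
  using integrable_Y[of i] transfer_to_first_step(2)[of "\<lambda>y. y" i] centred by simp

lemma orthogonal_steps:
  assumes "i \<noteq> j"
  shows "integrable M (\<lambda>\<omega>. Y i \<omega> \<bullet> Y j \<omega>)" and "expectation (\<lambda>\<omega>. Y i \<omega> \<bullet> Y j \<omega>) = 0"
proof -
  have *: "integrable M (\<lambda>\<omega>. (b \<bullet> Y i \<omega>) * (b \<bullet> Y j \<omega>)) \<and>
      expectation (\<lambda>\<omega>. (b \<bullet> Y i \<omega>) * (b \<bullet> Y j \<omega>)) = 0" for b
  proof -
    have "indep_vars (\<lambda>_. borel) (\<lambda>k \<omega>. b \<bullet> Y k \<omega>) {i, j}"
      by (rule indep_vars_compose2[OF indep_vars_subset[OF indep]]) auto
    moreover have "integrable M (\<lambda>\<omega>. b \<bullet> Y k \<omega>)" for k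
      by (rule integrable_inner_right) (rule integrable_Y)
    ultimately have "integrable M (\<lambda>\<omega>. \<Prod>k\<in>{i, j}. b \<bullet> Y k \<omega>)"
      and "expectation (\<lambda>\<omega>. \<Prod>k\<in>{i, j}. b \<bullet> Y k \<omega>) = (\<Prod>k\<in>{i, j}. expectation (\<lambda>\<omega>. b \<bullet> Y k \<omega>))"
      by (auto intro!: indep_vars_integrable indep_vars_lebesgue_integral)
    then show ?thesis
      using assms by (simp add: expectation_inner)
  qed
  have eq: "(\<lambda>\<omega>. Y i \<omega> \<bullet> Y j \<omega>) = (\<lambda>\<omega>. \<Sum>b\<in>Basis. (b \<bullet> Y i \<omega>) * (b \<bullet> Y j \<omega>))"
    by (subst euclidean_inner) (simp add: inner_commute)
  show "integrable M (\<lambda>\<omega>. Y i \<omega> \<bullet> Y j \<omega>)"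
    unfolding eq using * by auto
  show "expectation (\<lambda>\<omega>. Y i \<omega> \<bullet> Y j \<omega>) = 0"
    unfolding eq using * by (subst Bochner_Integration.integral_sum) auto
qed

lemma second_moment_increment:
  "integrable M (\<lambda>\<omega>. (norm (increment (steps \<omega>) s n))\<^sup>2)"
  "expectation (\<lambda>\<omega>. (norm (increment (steps \<omega>) s n))\<^sup>2) = n * total_variance"
proof -
  have eq: "(norm (increment (steps \<omega>) s n))\<^sup>2 = (\<Sum>i<n. \<Sum>j<n. Y (s + i) \<omega> \<bullet> Y (s + j) \<omega>)" for \<omega>
    by (simp add: increment_def power2_norm_eq_inner inner_sum_left inner_sum_right)
       (rule sum.swap)
  have diag: "integrable M (\<lambda>\<omega>. Y i \<omega> \<bullet> Y i \<omega>)"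
      "expectation (\<lambda>\<omega>. Y i \<omega> \<bullet> Y i \<omega>) = total_variance" for i
    using transfer_to_first_step[of "\<lambda>y. (norm y)\<^sup>2" i] square_integrable
    by (simp_all add: power2_norm_eq_inner)
  have all: "integrable M (\<lambda>\<omega>. Y i \<omega> \<bullet> Y j \<omega>)" for i j
    using diag orthogonal_steps by (cases "i = j") auto
  have e: "expectation (\<lambda>\<omega>. Y (s + i) \<omega> \<bullet> Y (s + j) \<omega>) = (if i = j then total_variance else 0)" for i j
    using diag orthogonal_steps by simp
  show "integrable M (\<lambda>\<omega>. (norm (increment (steps \<omega>) s n))\<^sup>2)"
    unfolding eq using all by simp
  show "expectation (\<lambda>\<omega>. (norm (increment (steps \<omega>) s n))\<^sup>2) = n * total_variance"
    unfolding eq using all by (simp add: e)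
qed

lemma increment_Chebyshev:
  assumes "c > 0"
  shows "prob {\<omega> \<in> space M. norm (increment (steps \<omega>) s n) \<ge> c} \<le> n * total_variance / c\<^sup>2"
proof -
  have "prob {\<omega> \<in> space M. norm (increment (steps \<omega>) s n) \<ge> c}
      = prob {\<omega> \<in> space M. c\<^sup>2 \<le> (norm (increment (steps \<omega>) s n))\<^sup>2}"
    using assms by (intro arg_cong[where f = prob]) (auto simp: abs_le_square_iff[symmetric])
  also have "\<dots> \<le> expectation (\<lambda>\<omega>. (norm (increment (steps \<omega>) s n))\<^sup>2) / c\<^sup>2"
    by (rule integral_Markov_inequality_measure[where A = "{}"])
       (use assms second_moment_increment in auto)
  finally show ?thesis
    by (simp add: second_moment_increment)
qed

end

section \<open>Maximal inequality and central limit theorem\<close>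

context iid_walk begin

lemma prob_inter_blocks:
  assumes "A \<inter> B = {}"
    and "Measurable.pred (Pi\<^sub>M UNIV (\<lambda>_. borel)) P" "Measurable.pred (Pi\<^sub>M UNIV (\<lambda>_. borel)) Q"
    and "\<And>f g. (\<And>i. i \<in> A \<Longrightarrow> f i = g i) \<Longrightarrow> P f \<Longrightarrow> P g"
    and "\<And>f g. (\<And>i. i \<in> B \<Longrightarrow> f i = g i) \<Longrightarrow> Q f \<Longrightarrow> Q g"
  shows "prob {\<omega> \<in> space M. P (steps \<omega>) \<and> Q (steps \<omega>)}
    = prob {\<omega> \<in> space M. P (steps \<omega>)} * prob {\<omega> \<in> space M. Q (steps \<omega>)}"
proof -
  have "indep_events (\<lambda>b. {\<omega> \<in> space M. (if b then P else Q) (steps \<omega>)}) (UNIV :: bool set)"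
  proof (rule indep_events_blocks[where K = "\<lambda>b. if b then A else B"])
    fix b and f g :: "nat \<Rightarrow> 'e"
    assume "\<And>i. i \<in> (if b then A else B) \<Longrightarrow> f i = g i" "(if b then P else Q) f"
    then show "(if b then P else Q) g"
      using assms(4)[of f g] assms(5)[of f g] by (cases b) auto
  qed (use assms in \<open>auto simp: disjoint_family_on_def\<close>)
  then have "prob (\<Inter>b\<in>UNIV. {\<omega> \<in> space M. (if b then P else Q) (steps \<omega>)})
      = (\<Prod>b\<in>UNIV. prob {\<omega> \<in> space M. (if b then P else Q) (steps \<omega>)})"
    by (rule indep_events_def[THEN iffD1, THEN conjunct2, rule_format]) auto
  moreover have "(\<Inter>b\<in>UNIV. {\<omega> \<in> space M. (if b then P else Q) (steps \<omega>)})
      = {\<omega> \<in> space M. P (steps \<omega>) \<and> Q (steps \<omega>)}"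
    by (simp add: UNIV_bool) blast
  ultimately show ?thesis
    by (simp add: UNIV_bool mult.commute)
qed

text \<open>Ottaviani's inequality. If the walk first leaves the ball of radius \<open>2 * c\<close> at time \<open>j\<close>, the remaining
steps, which are independent of this, move it by less than \<open>c\<close> with probability at least one half
(Chebyshev); then it ends outside the ball of radius \<open>c\<close>. So an excursion is at most twice as likely
as a distant endpoint, and Chebyshev bounds the latter.\<close>
lemma increment_maximal:
  fixes n :: nat
  assumes "c > 0" and half: "n * total_variance / c\<^sup>2 \<le> 1/2"
  shows "prob {\<omega> \<in> space M. \<exists>j\<le>n. norm (increment (steps \<omega>) 0 j) \<ge> 2 * c}
    \<le> 2 * (n * total_variance / c\<^sup>2)"
proof -
  define first where "first j f \<longleftrightarrow> (\<forall>i<j. norm (increment f 0 i) < 2 * c)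
      \<and> norm (increment f 0 j) \<ge> 2 * c" for j and f :: "nat \<Rightarrow> 'e"
  define stay where "stay j f \<longleftrightarrow> norm (increment f j (n - j)) < c" for j and f :: "nat \<Rightarrow> 'e"
  have first_meas [measurable]: "Measurable.pred (Pi\<^sub>M UNIV (\<lambda>_. borel)) (first j)" for j
    unfolding first_def by measurable
  have stay_meas [measurable]: "Measurable.pred (Pi\<^sub>M UNIV (\<lambda>_. borel)) (stay j)" for j
    unfolding stay_def by measurable
  have tv: "total_variance \<ge> 0"
    by simp
  have stay_prob: "prob {\<omega> \<in> space M. stay j (steps \<omega>)} \<ge> 1/2" for j
  proof -
    have "prob {\<omega> \<in> space M. \<not> stay j (steps \<omega>)} \<le> (n - j) * total_variance / c\<^sup>2"
      unfolding stay_def not_less by (rule increment_Chebyshev) fact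
    also have "\<dots> \<le> n * total_variance / c\<^sup>2"
      using tv by (intro divide_right_mono mult_right_mono) auto
    finally have "prob {\<omega> \<in> space M. \<not> stay j (steps \<omega>)} \<le> 1/2"
      using half by linarith
    then show ?thesis
      by (subst (asm) prob_neg) auto
  qed
  have split: "prob {\<omega> \<in> space M. first j (steps \<omega>) \<and> stay j (steps \<omega>)}
      = prob {\<omega> \<in> space M. first j (steps \<omega>)} * prob {\<omega> \<in> space M. stay j (steps \<omega>)}" for j
  proof (rule prob_inter_blocks[where A = "{..<j}" and B = "{j..}"])
    fix f g :: "nat \<Rightarrow> 'e" assume "\<And>i. i \<in> {..<j} \<Longrightarrow> f i = g i" and "first j f"
    moreover from this have "increment f 0 i = increment g 0 i" if "i \<le> j" for i
      using that by (intro increment_cong) auto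
    ultimately show "first j g"
      by (simp add: first_def)
  next
    fix f g :: "nat \<Rightarrow> 'e" assume "\<And>i. i \<in> {j..} \<Longrightarrow> f i = g i" and "stay j f"
    moreover from this have "increment f j (n - j) = increment g j (n - j)"
      by (intro increment_cong) auto
    ultimately show "stay j g"
      by (simp add: stay_def)
  qed auto
  have disj: "disjoint_family_on (\<lambda>j. {\<omega> \<in> space M. first j (steps \<omega>)}) {..n}"
    unfolding disjoint_family_on_def first_def
    by (auto, metis linorder_neqE_nat not_le)
  have disj': "disjoint_family_on (\<lambda>j. {\<omega> \<in> space M. first j (steps \<omega>) \<and> stay j (steps \<omega>)}) {..n}"
    using disj unfolding disjoint_family_on_def by blast
  have "prob {\<omega> \<in> space M. \<exists>j\<le>n. norm (increment (steps \<omega>) 0 j) \<ge> 2 * c}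
      \<le> prob (\<Union>j\<in>{..n}. {\<omega> \<in> space M. first j (steps \<omega>)})"
  proof (rule finite_measure_mono)
    show "{\<omega> \<in> space M. \<exists>j\<le>n. norm (increment (steps \<omega>) 0 j) \<ge> 2 * c}
        \<subseteq> (\<Union>j\<in>{..n}. {\<omega> \<in> space M. first j (steps \<omega>)})"
    proof safe
      fix \<omega> j assume "\<omega> \<in> space M" "j \<le> n" and j: "norm (increment (steps \<omega>) 0 j) \<ge> 2 * c"
      define l where "l = (LEAST j. norm (increment (steps \<omega>) 0 j) \<ge> 2 * c)"
      have "first l (steps \<omega>)"
        unfolding first_def l_def
        using LeastI[of "\<lambda>j. norm (increment (steps \<omega>) 0 j) \<ge> 2 * c", OF j]
          not_less_Least[of _ "\<lambda>j. norm (increment (steps \<omega>) 0 j) \<ge> 2 * c"] by force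
      moreover have "l \<le> n"
        using Least_le[of "\<lambda>j. norm (increment (steps \<omega>) 0 j) \<ge> 2 * c", OF j] \<open>j \<le> n\<close>
        by (simp add: l_def)
      ultimately show "\<omega> \<in> (\<Union>j\<in>{..n}. {\<omega> \<in> space M. first j (steps \<omega>)})"
        using \<open>\<omega> \<in> space M\<close> by auto
    qed
  qed measurable
  also have "\<dots> = (\<Sum>j\<le>n. prob {\<omega> \<in> space M. first j (steps \<omega>)})"
    by (rule finite_measure_finite_Union) (use disj in auto)
  also have "\<dots> \<le> (\<Sum>j\<le>n. 2 * prob {\<omega> \<in> space M. first j (steps \<omega>) \<and> stay j (steps \<omega>)})"
  proof (rule sum_mono)
    fix j
    have "prob {\<omega> \<in> space M. first j (steps \<omega>)} * (1/2)
        \<le> prob {\<omega> \<in> space M. first j (steps \<omega>)} * prob {\<omega> \<in> space M. stay j (steps \<omega>)}"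
      by (rule mult_left_mono[OF stay_prob]) simp
    then show "prob {\<omega> \<in> space M. first j (steps \<omega>)}
        \<le> 2 * prob {\<omega> \<in> space M. first j (steps \<omega>) \<and> stay j (steps \<omega>)}"
      by (simp add: split)
  qed
  also have "\<dots> = 2 * prob (\<Union>j\<in>{..n}. {\<omega> \<in> space M. first j (steps \<omega>) \<and> stay j (steps \<omega>)})"
    by (subst finite_measure_finite_Union) (use disj' in \<open>auto simp: sum_distrib_left\<close>)
  also have "\<dots> \<le> 2 * prob {\<omega> \<in> space M. norm (increment (steps \<omega>) 0 n) \<ge> c}"
  proof (intro mult_left_mono finite_measure_mono)
    show "(\<Union>j\<in>{..n}. {\<omega> \<in> space M. first j (steps \<omega>) \<and> stay j (steps \<omega>)})
        \<subseteq> {\<omega> \<in> space M. norm (increment (steps \<omega>) 0 n) \<ge> c}"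
    proof safe
      fix \<omega> j assume "j \<le> n" and a: "first j (steps \<omega>)" "stay j (steps \<omega>)"
      then have "increment (steps \<omega>) 0 n = increment (steps \<omega>) 0 j + increment (steps \<omega>) j (n - j)"
        using increment_add[of "steps \<omega>" 0 j "n - j"] by simp
      moreover have "norm (increment (steps \<omega>) 0 j) \<ge> 2 * c"
        and "norm (increment (steps \<omega>) j (n - j)) < c"
        using a by (auto simp: first_def stay_def)
      ultimately show "norm (increment (steps \<omega>) 0 n) \<ge> c"
        using norm_diff_ineq[of "increment (steps \<omega>) 0 j" "increment (steps \<omega>) j (n - j)"] by simp
    qed
  qed auto
  also have "\<dots> \<le> 2 * (n * total_variance / c\<^sup>2)"
    by (intro mult_left_mono increment_Chebyshev assms) auto
  finally show ?thesis .
qed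

text \<open>This is the only use of the central limit theorem. In direction \<open>\<theta>\<close>, with variance
\<open>\<sigma>\<^sup>2 \<ge> v\<close>, the normalised walk is below \<open>-1\<close> with a probability that converges to the mass \<open>q\<close>
that the standard normal law gives to \<open>{..-1}\<close>. This mass does not depend on \<open>\<theta>\<close>, so \<open>q / 2\<close> works for
every direction; only the threshold \<open>L0\<close> depends on the direction.\<close>
lemma half_space_CLT:
  "\<exists>p>0. \<forall>\<theta>. norm \<theta> = 1 \<longrightarrow> (\<exists>L0. \<forall>L\<ge>L0.
      p \<le> prob {\<omega> \<in> space M. \<theta> \<bullet> increment (steps \<omega>) 0 L \<le> - sqrt (v * L)})"
proof -
  let ?N = "std_normal_distribution"
  interpret N: real_distribution ?N
    by (rule real_dist_normal_dist)
  define q where "q = cdf ?N (- 1)"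
  have q_pos: "q > 0"
  proof (rule ccontr)
    assume "\<not> q > 0"
    then have "measure ?N {..- 1} = 0"
      using measure_nonneg[of ?N "{..- 1}"] by (simp add: q_def cdf_def)
    then have "{..- 1 :: real} \<in> null_sets ?N"
      by (simp add: N.emeasure_eq_measure null_sets_def)
    then have "AE x in lborel. x \<in> {..- 1 :: real} \<longrightarrow> ennreal (std_normal_density x) = 0"
      by (subst (asm) null_sets_density_iff) auto
    then have "AE x in lborel. x \<notin> {..- 1 :: real}"
    proof eventually_elim
      case (elim x)
      moreover have "std_normal_density x > 0"
        by (rule normal_density_pos) simp
      ultimately show ?case
        by (auto simp: ennreal_eq_0_iff)
    qed
    then have "emeasure lborel {..- 1 :: real} = 0"
      by (subst (asm) AE_iff_measurable[OF _ refl]) (auto simp: atMost_def)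
    moreover have "emeasure lborel {- 2..- 1 :: real} \<le> emeasure lborel {..- 1 :: real}"
      by (rule emeasure_mono) auto
    ultimately show False
      by simp
  qed
  have cont: "isCont (cdf ?N) (- 1)"
  proof -
    have "AE x in lborel. x \<noteq> (- 1 :: real)"
      by (rule AE_lborel_singleton)
    then have "AE x in lborel. x \<in> {- 1 :: real} \<longrightarrow> ennreal (std_normal_density x) = 0"
      by eventually_elim simp
    then have "{- 1 :: real} \<in> null_sets ?N"
      by (subst null_sets_density_iff) auto
    then show ?thesis
      by (auto simp: N.isCont_cdf measure_def null_sets_def)
  qed
  have "\<exists>L0. \<forall>L\<ge>L0. q / 2 \<le> prob {\<omega> \<in> space M. \<theta> \<bullet> increment (steps \<omega>) 0 L \<le> - sqrt (v * L)}"
    if \<theta>: "norm \<theta> = 1" for \<theta>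
  proof -
    define \<sigma> where "\<sigma> = sqrt (expectation (\<lambda>\<omega>. (\<theta> \<bullet> Y 0 \<omega>)\<^sup>2))"
    have \<sigma>2: "\<sigma>\<^sup>2 = expectation (\<lambda>\<omega>. (\<theta> \<bullet> Y 0 \<omega>)\<^sup>2)"
      unfolding \<sigma>_def by (rule real_sqrt_pow2) simp
    have v\<sigma>: "v \<le> \<sigma>\<^sup>2"
      using nondegenerate[of \<theta>] \<theta> by (simp add: \<sigma>2)
    then have \<sigma>_pos: "\<sigma> > 0"
      using v_pos by (simp add: \<sigma>_def)
    have "weak_conv_m (\<lambda>n. distr M borel (\<lambda>\<omega>. (\<Sum>i<n. \<theta> \<bullet> Y i \<omega>) / sqrt (n * \<sigma>\<^sup>2))) ?N"
    proof (rule central_limit_theorem_zero_mean[where \<mu> = "distr M borel (\<lambda>\<omega>. \<theta> \<bullet> Y 0 \<omega>)"])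
      show "indep_vars (\<lambda>_. borel) (\<lambda>i \<omega>. \<theta> \<bullet> Y i \<omega>) UNIV"
        by (rule indep_vars_compose2[OF indep]) simp
      show "distr M borel (\<lambda>\<omega>. \<theta> \<bullet> Y n \<omega>) = distr M borel (\<lambda>\<omega>. \<theta> \<bullet> Y 0 \<omega>)" for n
      proof -
        have "distr M borel (\<lambda>\<omega>. \<theta> \<bullet> Y k \<omega>) = distr (distr M borel (Y k)) borel ((\<bullet>) \<theta>)" for k
          by (subst distr_distr) (auto simp: comp_def)
        from this[of n] this[of 0] show ?thesis
          by (simp add: ident[of n])
      qed
      show "variance (\<lambda>\<omega>. \<theta> \<bullet> Y n \<omega>) = \<sigma>\<^sup>2" for n
        using transfer_to_first_step(2)[of "\<lambda>y. (\<theta> \<bullet> y)\<^sup>2" n] by (simp add: expectation_inner \<sigma>2)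
    qed (use \<sigma>_pos square_integrable_inner expectation_inner in auto)
    then have "(\<lambda>n. cdf (distr M borel (\<lambda>\<omega>. (\<Sum>i<n. \<theta> \<bullet> Y i \<omega>) / sqrt (n * \<sigma>\<^sup>2))) (- 1)) \<longlonglongrightarrow> q"
      using cont by (simp add: weak_conv_m_def weak_conv_def q_def)
    then have "eventually (\<lambda>n. cdf (distr M borel (\<lambda>\<omega>. (\<Sum>i<n. \<theta> \<bullet> Y i \<omega>) / sqrt (n * \<sigma>\<^sup>2))) (- 1) > q / 2) sequentially"
      by (rule order_tendstoD(1)) (use q_pos in simp)
    then have "eventually (\<lambda>n. q / 2 \<le> prob {\<omega> \<in> space M. \<theta> \<bullet> increment (steps \<omega>) 0 n \<le> - sqrt (v * n)}) sequentially"
      using eventually_gt_at_top[of 0]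
    proof eventually_elim
      case (elim n)
      have "q / 2 \<le> cdf (distr M borel (\<lambda>\<omega>. (\<Sum>i<n. \<theta> \<bullet> Y i \<omega>) / sqrt (n * \<sigma>\<^sup>2))) (- 1)"
        using elim by simp
      also have "\<dots> = prob {\<omega> \<in> space M. (\<Sum>i<n. \<theta> \<bullet> Y i \<omega>) / sqrt (n * \<sigma>\<^sup>2) \<le> - 1}"
        unfolding cdf_def by (subst measure_distr) (auto intro!: arg_cong[where f = prob])
      also have "\<dots> \<le> prob {\<omega> \<in> space M. \<theta> \<bullet> increment (steps \<omega>) 0 n \<le> - sqrt (v * n)}"
      proof (rule finite_measure_mono)
        show "{\<omega> \<in> space M. (\<Sum>i<n. \<theta> \<bullet> Y i \<omega>) / sqrt (n * \<sigma>\<^sup>2) \<le> - 1}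
            \<subseteq> {\<omega> \<in> space M. \<theta> \<bullet> increment (steps \<omega>) 0 n \<le> - sqrt (v * n)}"
        proof safe
          fix \<omega> assume "(\<Sum>i<n. \<theta> \<bullet> Y i \<omega>) / sqrt (n * \<sigma>\<^sup>2) \<le> - 1"
          then have "(\<Sum>i<n. \<theta> \<bullet> Y i \<omega>) \<le> - sqrt (n * \<sigma>\<^sup>2)"
            using elim \<sigma>_pos by (subst (asm) pos_divide_le_eq) auto
          moreover have "sqrt (v * n) \<le> sqrt (n * \<sigma>\<^sup>2)"
            using v\<sigma> by (intro real_sqrt_le_mono) (simp add: mult.commute[of v] mult_left_mono)
          ultimately show "\<theta> \<bullet> increment (steps \<omega>) 0 n \<le> - sqrt (v * n)"
            unfolding increment_def inner_sum_right add_0 by linarith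
        qed
      qed measurable
      finally show ?case .
    qed
    then show ?thesis
      by (simp add: eventually_sequentially)
  qed
  with q_pos show ?thesis
    by (intro exI[of _ "q / 2"]) auto
qed

end

section \<open>Displacements of a block and steering\<close>

text \<open>The event that one block of \<open>L\<close> steps ends near \<open>sqrt L *\<^sub>R w\<close> without a long excursion on the way;
\<open>sqrt L\<close> is the diffusive length scale, so the probabilities of these events do not degenerate as
\<open>L\<close> grows.\<close>
definition hits :: "(nat \<Rightarrow> 'e::euclidean_space) \<Rightarrow> nat \<Rightarrow> 'e \<Rightarrow> real \<Rightarrow> real \<Rightarrow> bool"
  where "hits f L w \<delta> C \<longleftrightarrow> norm (increment f 0 L - sqrt L *\<^sub>R w) \<le> \<delta> * sqrt L
    \<and> (\<forall>j\<le>L. norm (increment f 0 j) \<le> C * sqrt L)"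

lemma measurable_hits [measurable]:
  "Measurable.pred (Pi\<^sub>M UNIV (\<lambda>_. borel)) (\<lambda>f. hits f L w \<delta> C)"
  unfolding hits_def by measurable

context iid_walk begin

text \<open>A substitute for the planar central limit theorem. By the half-space estimate and the maximal
inequality, with probability at least \<open>p / 2\<close> a block moves backwards along \<open>\<theta>\<close> and stays in a ball of
radius \<open>C * sqrt L\<close>. Covering that ball by finitely many small balls, one of them is hit with at
least the average probability, and its centre is \<open>w\<close>. The centre may depend on \<open>L\<close> and
\<open>\<theta>\<close>, but \<open>a\<close>, \<open>C\<close> and \<open>q\<close> do not. Uniformity in \<open>\<theta>\<close> comes from a finite net
of directions, for which a common \<open>L0\<close> exists.\<close>
lemma one_block:
  "\<exists>a>0. \<exists>C>0. \<forall>\<delta>>0. \<exists>q>0. \<exists>L0. \<forall>L\<ge>L0. \<forall>\<theta>. norm \<theta> = 1 \<longrightarrow>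
      (\<exists>w. norm w \<le> C \<and> \<theta> \<bullet> w \<le> - a \<and> q \<le> prob {\<omega> \<in> space M. hits (steps \<omega>) L w \<delta> C})"
proof -
  obtain p where p: "p > 0"
    "\<And>\<theta>. norm \<theta> = 1 \<Longrightarrow> \<exists>L0. \<forall>L\<ge>L0.
      p \<le> prob {\<omega> \<in> space M. \<theta> \<bullet> increment (steps \<omega>) 0 L \<le> - sqrt (v * L)}"
    using half_space_CLT by blast
  have p_le_1: "p \<le> 1"
  proof -
    obtain \<theta> :: 'e where "norm \<theta> = 1"
      using vector_choose_size[of 1] by auto
    from p(2)[OF this] show ?thesis
      using order_trans[OF _ prob_le_1] by blast
  qed
  define T where "T = total_variance"
  have T: "T \<ge> 0"
    by (simp add: T_def)
  define a where "a = sqrt v / 2"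
  have a: "a > 0" "sqrt v = 2 * a"
    using v_pos by (simp_all add: a_def)
  \<comment> \<open>Large enough for the maximal inequality to cost at most \<open>p / 4\<close>.\<close>
  define C where "C = 32 * T / p + 1"
  have C: "C \<ge> 1"
    using T p by (simp add: C_def)
  have C2: "8 * T / C\<^sup>2 \<le> p / 4"
  proof -
    have "32 * T / p \<le> C\<^sup>2"
      using C power_increasing[of 1 2 C] by (simp add: C_def)
    then show ?thesis
      using C p by (simp add: field_simps)
  qed
  have large: "prob {\<omega> \<in> space M. \<exists>j\<le>L. norm (increment (steps \<omega>) 0 j) \<ge> C * sqrt L} \<le> p / 4"
    if "L \<ge> 1" for L
  proof -
    have eq: "L * T / (C * sqrt L / 2)\<^sup>2 = 4 * T / C\<^sup>2"
      using that C by (simp add: power_divide power_mult_distrib field_simps)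
    have "prob {\<omega> \<in> space M. \<exists>j\<le>L. norm (increment (steps \<omega>) 0 j) \<ge> 2 * (C * sqrt L / 2)}
        \<le> 2 * (L * T / (C * sqrt L / 2)\<^sup>2)"
      unfolding T_def
    proof (rule increment_maximal)
      show "L * total_variance / (C * sqrt L / 2)\<^sup>2 \<le> 1/2"
        using eq C2 p_le_1 by (simp add: T_def)
    qed (use C that in auto)
    then show ?thesis
      using C2 unfolding eq by simp
  qed
  \<comment> \<open>Replacing a direction by a net point changes the inner product with a vector of length \<open>C\<close> by
    at most \<open>a / 2\<close>; another \<open>a / 2\<close> is lost to the radius \<open>d\<close>, out of \<open>sqrt v = 2 * a\<close>.\<close>
  define \<kappa> where "\<kappa> = a / (2 * C)"
  have \<kappa>: "\<kappa> > 0" "\<kappa> * C = a / 2"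
    using a C by (simp_all add: \<kappa>_def)
  obtain \<Theta> :: "'e set" where \<Theta>: "finite \<Theta>" "\<Theta> \<subseteq> sphere 0 1" "sphere 0 1 \<subseteq> (\<Union>t\<in>\<Theta>. ball t \<kappa>)"
    using seq_compact_imp_totally_bounded[of "sphere (0::'e) 1"] \<kappa>
    by (auto simp flip: compact_eq_seq_compact_metric)
  have "\<exists>L0. \<forall>t\<in>\<Theta>. \<forall>L\<ge>L0.
      p \<le> prob {\<omega> \<in> space M. t \<bullet> increment (steps \<omega>) 0 L \<le> - sqrt (v * L)}"
  proof -
    have "\<forall>t\<in>\<Theta>. eventually (\<lambda>L. p \<le> prob {\<omega> \<in> space M. t \<bullet> increment (steps \<omega>) 0 L \<le> - sqrt (v * L)}) sequentially"
      using \<Theta> p(2) by (auto simp: eventually_sequentially)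
    then have "eventually (\<lambda>L. \<forall>t\<in>\<Theta>. p \<le> prob {\<omega> \<in> space M. t \<bullet> increment (steps \<omega>) 0 L \<le> - sqrt (v * L)}) sequentially"
      using \<Theta> by (simp add: eventually_ball_finite)
    then show ?thesis
      unfolding eventually_sequentially by blast
  qed
  then obtain L1 where L1: "\<And>t L. t \<in> \<Theta> \<Longrightarrow> L \<ge> L1 \<Longrightarrow>
      p \<le> prob {\<omega> \<in> space M. t \<bullet> increment (steps \<omega>) 0 L \<le> - sqrt (v * L)}"
    by blast
  have "\<exists>q>0. \<exists>L0. \<forall>L\<ge>L0. \<forall>\<theta>. norm \<theta> = 1 \<longrightarrow>
      (\<exists>w. norm w \<le> C \<and> \<theta> \<bullet> w \<le> - a \<and> q \<le> prob {\<omega> \<in> space M. hits (steps \<omega>) L w \<delta> C})"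
    if "\<delta> > 0" for \<delta>
  proof -
    define d where "d = min \<delta> (a / 2)"
    have d: "d > 0" "d \<le> \<delta>" "d \<le> a / 2"
      using that a by (auto simp: d_def)
    obtain W :: "'e set" where W: "finite W" "W \<subseteq> cball 0 C" "cball 0 C \<subseteq> (\<Union>w\<in>W. ball w d)"
      using seq_compact_imp_totally_bounded[of "cball (0::'e) C"] d
      by (auto simp flip: compact_eq_seq_compact_metric)
    have "W \<noteq> {}"
      using W(3) C by auto
    then have card_W: "card W > 0"
      using W by (simp add: card_gt_0_iff)
    define q where "q = p / 2 / card W"
    have q: "q > 0"
      using p card_W by (simp add: q_def)
    have "\<exists>w. norm w \<le> C \<and> \<theta> \<bullet> w \<le> - a \<and> q \<le> prob {\<omega> \<in> space M. hits (steps \<omega>) L w \<delta> C}"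
      if L: "L \<ge> max 1 L1" and \<theta>: "norm \<theta> = 1" for L \<theta>
    proof -
      have sqrt_L: "sqrt L > 0"
        using L by simp
      obtain t where t: "t \<in> \<Theta>" "norm (\<theta> - t) < \<kappa>"
        using \<Theta>(3) \<theta> by (auto simp: dist_norm norm_minus_commute subset_iff)
      let ?H = "\<lambda>\<omega>. t \<bullet> increment (steps \<omega>) 0 L \<le> - sqrt (v * L)"
      let ?B = "\<lambda>\<omega>. \<exists>j\<le>L. norm (increment (steps \<omega>) 0 j) \<ge> C * sqrt L"
      define E where "E w = {\<omega> \<in> space M. hits (steps \<omega>) L w d C \<and> ?H \<omega>}" for w
      have E_meas [measurable]: "E w \<in> events" for w
        unfolding E_def hits_def by measurable
      have B_meas: "{\<omega> \<in> space M. ?B \<omega>} \<in> events"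
        by measurable
      have U_meas: "(\<Union>w\<in>W. E w) \<in> events"
        using W by auto
      have "p \<le> prob {\<omega> \<in> space M. ?H \<omega>}"
        using L1[OF t(1)] L by simp
      also have "\<dots> \<le> prob ({\<omega> \<in> space M. ?B \<omega>} \<union> (\<Union>w\<in>W. E w))"
      proof (rule finite_measure_mono)
        show "{\<omega> \<in> space M. ?H \<omega>} \<subseteq> {\<omega> \<in> space M. ?B \<omega>} \<union> (\<Union>w\<in>W. E w)"
        proof (intro subsetI)
          fix \<omega> assume \<omega>: "\<omega> \<in> {\<omega> \<in> space M. ?H \<omega>}"
          show "\<omega> \<in> {\<omega> \<in> space M. ?B \<omega>} \<union> (\<Union>w\<in>W. E w)"
          proof (cases "?B \<omega>")
            case False
            then have small: "norm (increment (steps \<omega>) 0 j) \<le> C * sqrt L" if "j \<le> L" for j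
              using that by (meson linear)
            let ?z = "inverse (sqrt L) *\<^sub>R increment (steps \<omega>) 0 L"
            have "?z \<in> cball 0 C"
              using small[of L] sqrt_L by (simp add: field_simps)
            with W(3) have "?z \<in> (\<Union>w\<in>W. ball w d)"
              by (rule subsetD)
            then obtain w where w: "w \<in> W" "dist w ?z < d"
              unfolding UN_iff mem_ball by blast
            have "norm (increment (steps \<omega>) 0 L - sqrt L *\<^sub>R w) = norm (sqrt L *\<^sub>R (?z - w))"
              using sqrt_L by (simp add: scaleR_diff_right)
            also have "\<dots> \<le> d * sqrt L"
              using w sqrt_L by (simp add: dist_norm norm_minus_commute mult.commute)
            finally have "hits (steps \<omega>) L w d C"
              using small by (simp add: hits_def)
            then show ?thesis
              using \<omega> w by (auto simp: E_def)
          qed (use \<omega> in auto)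
        qed
      qed (use B_meas U_meas in auto)
      also have "\<dots> \<le> prob {\<omega> \<in> space M. ?B \<omega>} + prob (\<Union>w\<in>W. E w)"
        by (rule measure_Un_le) (use B_meas U_meas in auto)
      finally have "p \<le> prob {\<omega> \<in> space M. ?B \<omega>} + prob (\<Union>w\<in>W. E w)" .
      moreover have "prob (\<Union>w\<in>W. E w) \<le> (\<Sum>w\<in>W. prob (E w))"
        by (rule measure_UNION_le) (use W in auto)
      moreover have "prob {\<omega> \<in> space M. ?B \<omega>} \<le> p / 4"
        using large L by simp
      ultimately have sum_ge: "p / 2 \<le> (\<Sum>w\<in>W. prob (E w))"
        using p(1) by linarith
      obtain w where w: "w \<in> W" "q \<le> prob (E w)"
      proof (rule ccontr)
        assume "\<not> thesis"
        then have "prob (E w) < q" if "w \<in> W" for w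
          using that \<open>\<And>w. w \<in> W \<Longrightarrow> q \<le> prob (E w) \<Longrightarrow> thesis\<close> by force
        then have "(\<Sum>w\<in>W. prob (E w)) < (\<Sum>w\<in>W. q)"
          by (intro sum_strict_mono) (use W \<open>W \<noteq> {}\<close> in auto)
        also have "\<dots> = p / 2"
          using card_W by (simp add: q_def)
        finally show False
          using sum_ge by simp
      qed
      \<comment> \<open>An outcome in this event ends in the half-space and close to \<open>w\<close>, so \<open>w\<close> itself points
        backwards.\<close>
      have "E w \<noteq> {}"
        using w(2) q by auto
      then obtain \<omega> where \<omega>: "hits (steps \<omega>) L w d C" "?H \<omega>"
        by (auto simp: E_def)
      have norm_t: "norm t = 1"
        using t \<Theta>(2) by auto
      have "t \<bullet> (sqrt L *\<^sub>R w) \<le> - sqrt (v * L) + d * sqrt L"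
      proof -
        have "t \<bullet> (sqrt L *\<^sub>R w - increment (steps \<omega>) 0 L)
            \<le> norm t * norm (sqrt L *\<^sub>R w - increment (steps \<omega>) 0 L)"
          by (rule norm_cauchy_schwarz)
        also have "\<dots> \<le> d * sqrt L"
          using \<omega>(1) norm_t by (simp add: hits_def norm_minus_commute)
        finally show ?thesis
          using \<omega>(2) by (simp add: inner_diff_right)
      qed
      also have "\<dots> = sqrt L * (d - 2 * a)"
        by (simp add: real_sqrt_mult a algebra_simps)
      finally have "t \<bullet> w \<le> d - 2 * a"
        using sqrt_L by simp
      moreover have norm_w: "norm w \<le> C"
        using w W by auto
      moreover have "(\<theta> - t) \<bullet> w \<le> \<kappa> * C"
        by (rule order_trans[OF norm_cauchy_schwarz mult_mono])
           (use t norm_w \<kappa> in auto)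
      ultimately have "\<theta> \<bullet> w \<le> - a"
        using d(3) \<kappa>(2) by (simp add: inner_diff_left)
      moreover have "q \<le> prob {\<omega> \<in> space M. hits (steps \<omega>) L w \<delta> C}"
      proof (rule order_trans[OF w(2)], rule finite_measure_mono)
        have "d * sqrt L \<le> \<delta> * sqrt L"
          using d(2) by (intro mult_right_mono) auto
        then show "E w \<subseteq> {\<omega> \<in> space M. hits (steps \<omega>) L w \<delta> C}"
          by (auto simp: E_def hits_def)
        show "{\<omega> \<in> space M. hits (steps \<omega>) L w \<delta> C} \<in> events"
          unfolding hits_def by measurable
      qed
      ultimately show ?thesis
        using norm_w by blast
    qed
    with q show ?thesis
      by blast
  qed
  moreover have "C > 0"
    using C by simp
  ultimately show ?thesis
    using a(1) by blast
qed

end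

text \<open>If moves are available that go backwards along any prescribed direction, choosing at each time the
move against the current error \<open>e = x i - u i\<close> keeps the error bounded while the target \<open>u\<close>
moves slowly: with \<open>h\<close> the change of the error,
\<open>(norm (e + h))\<^sup>2 \<le> (norm e)\<^sup>2 - 2 * (a - b) * norm e + (C + b)\<^sup>2\<close>, so the error
cannot grow once it exceeds \<open>(C + b)\<^sup>2 / (2 * (a - b))\<close>. In the application \<open>G w\<close> says that
a block of the walk makes the move \<open>w\<close> with probability bounded below, so the whole path \<open>x\<close> is
deterministic.\<close>
lemma steering:
  fixes u :: "nat \<Rightarrow> 'e::euclidean_space"
  assumes b: "0 \<le> b" "b < a"
    and G: "\<And>\<theta>. norm \<theta> = 1 \<Longrightarrow> \<exists>w. norm w \<le> C \<and> \<theta> \<bullet> w \<le> - a \<and> G w"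
    and u: "u 0 = 0" "\<And>i. norm (u (Suc i) - u i) \<le> b"
  obtains x where "x 0 = 0" "\<And>i. G (x (Suc i) - x i)"
    "\<And>i. norm (x i - u i) \<le> (C + b)\<^sup>2 / (2 * (a - b)) + C + b"
proof -
  define D where "D = (C + b)\<^sup>2 / (2 * (a - b))"
  obtain \<theta>0 :: 'e where \<theta>0: "norm \<theta>0 = 1"
    using vector_choose_size[of 1] by auto
  have C: "C \<ge> 0"
    using G[OF \<theta>0] norm_ge_zero order_trans by blast
  define dir where "dir e = (if e = 0 then \<theta>0 else e /\<^sub>R norm e)" for e :: 'e
  have dir: "norm (dir e) = 1" "e = norm e *\<^sub>R dir e" for e
    using \<theta>0 by (auto simp: dir_def)
  from G obtain g where g: "\<And>\<theta>. norm \<theta> = 1 \<Longrightarrow> norm (g \<theta>) \<le> C \<and> \<theta> \<bullet> g \<theta> \<le> - a \<and> G (g \<theta>)"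
    by metis
  define x where "x = rec_nat 0 (\<lambda>i y. y + g (dir (y - u i)))"
  have x: "x 0 = 0" "x (Suc i) = x i + g (dir (x i - u i))" for i
    by (simp_all add: x_def)
  have "norm (x i - u i) \<le> D + C + b" for i
  proof (induction i)
    case 0
    then show ?case
      using u x b C by (simp add: D_def)
  next
    case (Suc i)
    define e where "e = x i - u i"
    define h where "h = g (dir e) - (u (Suc i) - u i)"
    have step: "x (Suc i) - u (Suc i) = e + h"
      by (simp add: x e_def h_def)
    have h: "norm h \<le> C + b"
      using g[OF dir(1), of e] u(2)[of i] norm_triangle_ineq4[of "g (dir e)" "u (Suc i) - u i"]
      unfolding h_def by linarith
    show ?case
    proof (cases "norm e \<le> D")
      case True
      then show ?thesis
        unfolding step using h norm_triangle_ineq[of e h] by linarith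
    next
      case False
      have "- (dir e \<bullet> (u (Suc i) - u i)) \<le> b"
        using Cauchy_Schwarz_ineq2[of "dir e" "u (Suc i) - u i"] u(2)[of i] by (simp add: dir)
      then have "dir e \<bullet> h \<le> - (a - b)"
        using g[OF dir(1), of e] by (simp add: h_def inner_diff_right)
      then have "norm e * (dir e \<bullet> h) \<le> norm e * (- (a - b))"
        by (rule mult_left_mono) simp
      moreover have "e \<bullet> h = norm e * (dir e \<bullet> h)"
        by (subst dir(2)) simp
      moreover have "(C + b)\<^sup>2 \<le> 2 * (a - b) * norm e"
        using False b by (simp add: D_def field_simps)
      moreover have "(norm h)\<^sup>2 \<le> (C + b)\<^sup>2"
        by (rule power_mono[OF h]) simp
      moreover have "(norm (e + h))\<^sup>2 = (norm e)\<^sup>2 + 2 * (e \<bullet> h) + (norm h)\<^sup>2"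
        by (simp add: power2_norm_eq_inner inner_add_left inner_add_right inner_commute)
      ultimately have "(norm (e + h))\<^sup>2 \<le> (norm e)\<^sup>2"
        by (simp add: algebra_simps)
      then have "norm (e + h) \<le> norm e"
        by (rule power2_le_imp_le) simp
      then show ?thesis
        unfolding step using Suc by (simp add: e_def)
    qed
  qed
  moreover have "G (x (Suc i) - x i)" for i
    using g[OF dir(1)] by (simp add: x)
  ultimately show ?thesis
    using x by (intro that[of x]) (auto simp: D_def)
qed

lemma endpoint_error:
  assumes "\<And>i. i < m \<Longrightarrow> hits (\<lambda>k. f (s + i * L + k)) L (x (Suc i) - x i) \<delta> C"
    and "x 0 = 0" "i \<le> m"
  shows "norm (increment f s (i * L) - sqrt L *\<^sub>R x i) \<le> i * \<delta> * sqrt L"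
  using assms(3)
proof (induction i)
  case (Suc i)
  have "increment f s (Suc i * L) - sqrt L *\<^sub>R x (Suc i)
      = (increment f s (i * L) - sqrt L *\<^sub>R x i)
        + (increment f (s + i * L) L - sqrt L *\<^sub>R (x (Suc i) - x i))"
    using increment_add[of f s "i * L" L] by (simp add: algebra_simps)
  also have "norm \<dots> \<le> i * \<delta> * sqrt L + \<delta> * sqrt L"
    using Suc assms(1)[of i]
    by (intro norm_triangle_mono) (auto simp: hits_def increment_shift)
  finally show ?case
    by (simp add: algebra_simps)
qed (simp add: assms)

context iid_walk begin

text \<open>The walk follows any slow path \<open>u\<close> (in units of \<open>sqrt L\<close>), with an error \<open>C\<close> that does not depend on
the path or on its length \<open>m\<close>, with a probability \<open>q\<close> that does not depend on \<open>L\<close>. Steering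
supplies the moves, one block of \<open>L\<close> steps performs each of them, and the blocks are independent.\<close>
lemma tracking:
  "\<exists>b>0. \<exists>C>0. \<forall>m u. u 0 = 0 \<and> (\<forall>i. norm (u (Suc i) - u i) \<le> b) \<longrightarrow>
    (\<exists>q>0. \<exists>L0. \<forall>L\<ge>L0. \<forall>s. q \<le> prob {\<omega> \<in> space M. \<forall>i<m. \<forall>j\<le>L.
      norm (increment (steps \<omega>) s (i * L + j) - sqrt L *\<^sub>R u i) \<le> C * sqrt L})"
proof -
  obtain a C1 where a: "a > 0" and C1: "C1 > 0"
    and block: "\<And>\<delta>. \<delta> > 0 \<Longrightarrow> \<exists>q>0. \<exists>L0. \<forall>L\<ge>L0. \<forall>\<theta>. norm \<theta> = 1 \<longrightarrow>
      (\<exists>w. norm w \<le> C1 \<and> \<theta> \<bullet> w \<le> - a \<and> q \<le> prob {\<omega> \<in> space M. hits (steps \<omega>) L w \<delta> C1})"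
    using one_block by blast
  define b where "b = a / 2"
  define D where "D = (C1 + b)\<^sup>2 / (2 * (a - b)) + C1 + b"
  have b: "0 < b" "0 \<le> b" "b < a"
    using a by (auto simp: b_def)
  have D: "D > 0"
    using b C1 by (simp add: D_def add_pos_pos add_nonneg_pos)
  have "\<exists>q>0. \<exists>L0. \<forall>L\<ge>L0. \<forall>s. q \<le> prob {\<omega> \<in> space M. \<forall>i<m. \<forall>j\<le>L.
        norm (increment (steps \<omega>) s (i * L + j) - sqrt L *\<^sub>R u i) \<le> (1 + D + C1) * sqrt L}"
    if u: "u 0 = 0" "\<And>i. norm (u (Suc i) - u i) \<le> b" for m u
  proof -
    \<comment> \<open>The errors at the ends of the \<open>m\<close> blocks then add up to at most \<open>sqrt L\<close>.\<close>
    define \<delta> :: real where "\<delta> = 1 / (m + 1)"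
    have \<delta>: "\<delta> > 0" "i \<le> m \<Longrightarrow> i * \<delta> \<le> 1" for i
      by (simp_all add: \<delta>_def)
    obtain q L0 where q: "q > 0"
      and L0: "\<And>L \<theta>. L \<ge> L0 \<Longrightarrow> norm \<theta> = 1 \<Longrightarrow>
        \<exists>w. norm w \<le> C1 \<and> \<theta> \<bullet> w \<le> - a \<and> q \<le> prob {\<omega> \<in> space M. hits (steps \<omega>) L w \<delta> C1}"
      using block[OF \<delta>(1)] by blast
    have "q ^ m \<le> prob {\<omega> \<in> space M. \<forall>i<m. \<forall>j\<le>L.
        norm (increment (steps \<omega>) s (i * L + j) - sqrt L *\<^sub>R u i) \<le> (1 + D + C1) * sqrt L}"
      (is "_ \<le> prob ?track") if L: "L \<ge> L0" for L s
    proof -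
      define G where "G w \<longleftrightarrow> q \<le> prob {\<omega> \<in> space M. hits (steps \<omega>) L w \<delta> C1}" for w
      have "\<exists>w. norm w \<le> C1 \<and> \<theta> \<bullet> w \<le> - a \<and> G w" if "norm \<theta> = 1" for \<theta>
        using L0[OF L that] by (simp add: G_def)
      from steering[OF b(2,3) this u] obtain x where x: "x 0 = 0"
        "\<And>i. G (x (Suc i) - x i)" "\<And>i. norm (x i - u i) \<le> D"
        unfolding D_def by blast
      define P where "P i f \<longleftrightarrow> hits (\<lambda>k. f (s + i * L + k)) L (x (Suc i) - x i) \<delta> C1"
        for i and f :: "nat \<Rightarrow> 'e"
      have P_meas [measurable]: "Measurable.pred (Pi\<^sub>M UNIV (\<lambda>_. borel)) (P i)" for i
        unfolding P_def hits_def increment_shift by measurable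
      have P_prob: "q \<le> prob {\<omega> \<in> space M. P i (steps \<omega>)}" for i
        using steps_stationary[OF measurable_hits, of "s + i * L" L "x (Suc i) - x i" \<delta> C1] x(2)[of i]
        by (simp add: G_def P_def)
      define E where "E i = {\<omega> \<in> space M. P i (steps \<omega>)}" for i
      have E_meas [measurable]: "E i \<in> events" for i
        using measurable_compose[OF measurable_steps P_meas[of i]] by (simp add: E_def pred_def)
      have indep_E: "indep_events E {..<m}"
        unfolding E_def
      proof (rule indep_events_blocks[where K = "\<lambda>i. {s + i * L..<s + Suc i * L}"])
        show "disjoint_family_on (\<lambda>i. {s + i * L..<s + Suc i * L}) {..<m}"
          unfolding disjoint_family_on_def
        proof (intro ballI impI)
          have *: "{s + i * L..<s + Suc i * L} \<inter> {s + j * L..<s + Suc j * L} = {}" if "i < j" for i j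
            using mult_le_mono1[of "Suc i" j L] that by auto
          fix i j :: nat assume "i \<noteq> j"
          then show "{s + i * L..<s + Suc i * L} \<inter> {s + j * L..<s + Suc j * L} = {}"
            using *[of i j] *[of j i] by (cases "i < j") auto
        qed
      next
        fix i and f g :: "nat \<Rightarrow> 'e"
        assume eq: "\<And>k. k \<in> {s + i * L..<s + Suc i * L} \<Longrightarrow> f k = g k" and "P i f"
        have "increment f (s + i * L) j = increment g (s + i * L) j" if "j \<le> L" for j
          using that by (intro increment_cong eq) auto
        then show "P i g"
          using \<open>P i f\<close> by (simp add: P_def hits_def increment_shift)
      qed measurable
      have "q ^ m \<le> (\<Prod>i<m. prob (E i))"
        using prod_mono[of "{..<m}" "\<lambda>_. q" "\<lambda>i. prob (E i)"] P_prob q by (simp add: E_def)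
      also have "\<dots> \<le> prob ?track"
      proof (cases "m = 0")
        case True
        then show ?thesis
          by (simp add: prob_space)
      next
        case False
        then have "(\<Prod>i<m. prob (E i)) = prob (\<Inter>i<m. E i)"
          using indep_E[THEN indep_events_def[THEN iffD1], THEN conjunct2, rule_format, of "{..<m}"]
          by (simp add: lessThan_empty_iff)
        also have "\<dots> \<le> prob ?track"
        proof (rule finite_measure_mono)
          show "(\<Inter>i<m. E i) \<subseteq> ?track"
          proof safe
            fix \<omega> assume \<omega>: "\<omega> \<in> (\<Inter>i<m. E i)"
            then show "\<omega> \<in> space M"
              using False by (auto simp: E_def)
            fix i j assume ij: "i < m" "j \<le> L"
            let ?f = "steps \<omega>"
            have hit: "hits (\<lambda>k. ?f (s + i * L + k)) L (x (Suc i) - x i) \<delta> C1" if "i < m" for i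
              using \<omega> that by (auto simp: E_def P_def)
            have "increment ?f s (i * L + j) - sqrt L *\<^sub>R u i
                = ((increment ?f s (i * L) - sqrt L *\<^sub>R x i) + sqrt L *\<^sub>R (x i - u i))
                  + increment ?f (s + i * L) j"
              using increment_add[of ?f s "i * L" j] by (simp add: scaleR_diff_right)
            also have "norm \<dots> \<le> (1 * sqrt L + D * sqrt L) + C1 * sqrt L"
            proof (intro norm_triangle_mono)
              show "norm (increment ?f s (i * L) - sqrt L *\<^sub>R x i) \<le> 1 * sqrt L"
              proof (rule order_trans)
                show "norm (increment ?f s (i * L) - sqrt L *\<^sub>R x i) \<le> i * \<delta> * sqrt L"
                  by (rule endpoint_error[of m ?f s L x \<delta> C1 i, OF hit x(1) less_imp_le[OF ij(1)]])
                show "i * \<delta> * sqrt L \<le> 1 * sqrt L"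
                  using ij(1) by (intro mult_right_mono \<delta>(2)) auto
              qed
              show "norm (sqrt L *\<^sub>R (x i - u i)) \<le> D * sqrt L"
                using x(3)[of i] by (simp add: mult.commute[of D] mult_left_mono)
              show "norm (increment ?f (s + i * L) j) \<le> C1 * sqrt L"
                using hit[OF ij(1)] ij(2) by (simp add: hits_def increment_shift[of ?f])
            qed
            finally show "norm (increment ?f s (i * L + j) - sqrt L *\<^sub>R u i) \<le> (1 + D + C1) * sqrt L"
              by (simp add: algebra_simps)
          qed
        qed measurable
        finally show ?thesis .
      qed
      finally show ?thesis .
    qed
    then show ?thesis
      using q by (intro exI[of _ "q ^ m"]) auto
  qed
  moreover have "1 + D + C1 > 0"
    using D C1 by simp
  ultimately show ?thesis
    using b(1) by blast
qed

end

section \<open>Closeness infinitely often\<close>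

text \<open>Borel's zero-one law replaces the second Borel-Cantelli lemma: the upper limit of the events has
probability at least \<open>q\<close>.\<close>
lemma (in prob_space) AE_infinitely_often:
  assumes indep: "indep_events F (UNIV :: nat set)" and "q > 0" and q: "\<And>k. q \<le> prob (F k)"
  shows "AE \<omega> in M. \<exists>\<^sub>\<infinity>k. \<omega> \<in> F k"
proof -
  have F [measurable]: "F k \<in> events" for k
    using indep by (auto simp: indep_events_def)
  let ?A = "\<lambda>n. \<Union>k\<in>{n..}. F k"
  have "decseq ?A"
    by (intro decseq_SucI UN_mono) auto
  then have "(\<lambda>n. prob (?A n)) \<longlonglongrightarrow> prob (\<Inter>n. ?A n)"
    by (intro finite_Lim_measure_decseq) auto
  moreover have "q \<le> prob (?A n)" for n
    by (rule order_trans[OF q[of n] finite_measure_mono]) auto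
  ultimately have "q \<le> prob (\<Inter>n. ?A n)"
    by (intro LIMSEQ_le_const) auto
  then have "prob (\<Inter>n. ?A n) = 1"
    using borel_0_1_law[OF indep] \<open>q > 0\<close> by auto
  then have "AE \<omega> in M. \<omega> \<in> (\<Inter>n. ?A n)"
    by (subst (asm) prob_eq_1) auto
  then show ?thesis
    by eventually_elim (auto simp: INFM_nat_le)
qed

context iid_walk begin

lemma past_negligible:
  assumes "c > 0" "\<delta> > 0"
  shows "\<forall>\<^sub>F L in sequentially.
    prob {\<omega> \<in> space M. \<exists>j\<le>n. norm (increment (steps \<omega>) 0 j) \<ge> c * sqrt L} \<le> \<delta>"
proof -
  define \<epsilon> where "\<epsilon> = min (1/2) (\<delta>/2)"
  have \<epsilon>: "\<epsilon> > 0" "\<epsilon> \<le> 1/2" "2 * \<epsilon> \<le> \<delta>"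
    using assms by (auto simp: \<epsilon>_def)
  have "(\<lambda>L. 4 * n * total_variance / c\<^sup>2 * inverse (real L)) \<longlonglongrightarrow> 0"
    by (intro tendsto_mult_right_zero lim_inverse_n)
  then have "\<forall>\<^sub>F L in sequentially. 4 * n * total_variance / c\<^sup>2 * inverse (real L) < \<epsilon>"
    using \<epsilon> by (intro order_tendstoD) auto
  then show ?thesis
    using eventually_gt_at_top[of 0]
  proof eventually_elim
    case (elim L)
    have eq: "n * total_variance / (c * sqrt L / 2)\<^sup>2 = 4 * n * total_variance / c\<^sup>2 * inverse (real L)"
      using elim by (simp add: power_divide power_mult_distrib field_simps)
    have "n * total_variance / (c * sqrt L / 2)\<^sup>2 \<le> 1/2"
      using elim(1) \<epsilon>(2) unfolding eq by linarith
    then have "prob {\<omega> \<in> space M. \<exists>j\<le>n. norm (increment (steps \<omega>) 0 j) \<ge> 2 * (c * sqrt L / 2)}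
        \<le> 2 * (n * total_variance / (c * sqrt L / 2)\<^sup>2)"
      by (intro increment_maximal) (use elim(2) assms(1) in auto)
    also have "\<dots> \<le> \<delta>"
      using elim \<epsilon> unfolding eq by linarith
    finally show ?case
      by simp
  qed
qed

text \<open>Cut time into successive windows, the \<open>k\<close>-th made of \<open>m\<close> blocks of length \<open>l k\<close>, where \<open>l k\<close> is so
large that the walk before the window is small on the scale \<open>sqrt (l k)\<close> except with probability
\<open>(1/2) ^ k\<close>. Borel-Cantelli makes the past negligible for almost all windows, while the independent
tracking events happen in infinitely many of them.\<close>
lemma infinitely_often_close:
  fixes K :: "'e set"
  assumes K: "compact K" "convex K" "0 \<in> K" "diameter K = 1" and "e > 0"
  defines "H \<equiv> \<lambda>\<omega> n. convex hull ((\<lambda>k. increment (steps \<omega>) 0 k) ` {0..n})"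
  shows "AE \<omega> in M. \<exists>\<^sub>\<infinity>n.
    hausdorff_distance ((\<lambda>x. inverse (diameter (H \<omega> n)) *\<^sub>R x) ` H \<omega> n) K \<le> e"
proof -
  define \<epsilon> where "\<epsilon> = min e 1 / 9"
  have \<epsilon>: "0 < \<epsilon>" "\<epsilon> < 1/6" "9 * \<epsilon> \<le> e"
    using \<open>e > 0\<close> by (auto simp: \<epsilon>_def)
  obtain b C where b: "b > 0" and C: "C > 0"
    and track: "\<And>m u. u 0 = 0 \<Longrightarrow> (\<And>i. norm (u (Suc i) - u i) \<le> b) \<Longrightarrow>
      \<exists>q>0. \<exists>L0. \<forall>L\<ge>L0. \<forall>s. q \<le> prob {\<omega> \<in> space M. \<forall>i<m. \<forall>j\<le>L.
        norm (increment (steps \<omega>) s (i * L + j) - sqrt L *\<^sub>R u i) \<le> C * sqrt L}"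
    using tracking by blast
  \<comment> \<open>\<open>K\<close> is magnified by \<open>\<rho>\<close> (in units of \<open>sqrt L\<close>), so that the fixed tracking error \<open>C\<close> is the
    proportion \<open>\<epsilon>\<close> of its size. Only then is the path through \<open>K\<close> chosen, with steps that are
    slow enough after the magnification.\<close>
  define \<rho> where "\<rho> = C / \<epsilon>"
  have \<rho>: "\<rho> > 0" "C = \<epsilon> * \<rho>"
    using C \<epsilon> by (auto simp: \<rho>_def)
  obtain V where V: "finite V" "V \<subseteq> K" "K \<subseteq> (\<Union>x\<in>V. ball x \<epsilon>)"
    using seq_compact_imp_totally_bounded[of K] K(1) \<epsilon>(1)
    by (auto simp flip: compact_eq_seq_compact_metric)
  obtain m u where m: "m > 0" and u: "u 0 = 0" "\<And>i. u i \<in> K" "\<And>i. norm (u (Suc i) - u i) \<le> b / \<rho>"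
    and V_u: "V \<subseteq> u ` {..<m}"
    using dense_path[OF K(2,3) V(1,2), of "b / \<rho>"] b \<rho> by auto
  have net: "K \<subseteq> (\<Union>i<m. ball (u i) \<epsilon>)"
    using order_trans[OF V(3) UN_mono[OF V_u order_refl]] by (simp add: image_image)
  have "norm (\<rho> *\<^sub>R u (Suc i) - \<rho> *\<^sub>R u i) \<le> b" for i
  proof -
    have "norm (\<rho> *\<^sub>R (u (Suc i) - u i)) \<le> b"
      using u(3)[of i] \<rho>(1) by (simp add: pos_le_divide_eq mult.commute)
    then show ?thesis
      by (simp add: scaleR_diff_right)
  qed
  then have "\<exists>q>0. \<exists>L0. \<forall>L\<ge>L0. \<forall>s. q \<le> prob {\<omega> \<in> space M. \<forall>i<m. \<forall>j\<le>L.
        norm (increment (steps \<omega>) s (i * L + j) - sqrt L *\<^sub>R (\<rho> *\<^sub>R u i)) \<le> C * sqrt L}"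
    using u(1) by (intro track) simp_all
  then obtain q L0 where q: "q > 0"
    and L0: "\<And>L s. L \<ge> L0 \<Longrightarrow> q \<le> prob {\<omega> \<in> space M. \<forall>i<m. \<forall>j\<le>L.
        norm (increment (steps \<omega>) s (i * L + j) - sqrt L *\<^sub>R (\<rho> *\<^sub>R u i)) \<le> C * sqrt L}"
    by blast
  define len where "len k n = (SOME L. L \<ge> max L0 1 \<and>
      prob {\<omega> \<in> space M. \<exists>j\<le>n. norm (increment (steps \<omega>) 0 j) \<ge> C * sqrt L} \<le> (1/2) ^ k)" for k n
  have len: "len k n \<ge> max L0 1 \<and>
      prob {\<omega> \<in> space M. \<exists>j\<le>n. norm (increment (steps \<omega>) 0 j) \<ge> C * sqrt (len k n)} \<le> (1/2) ^ k"
    for k n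
  proof -
    have "\<forall>\<^sub>F L in sequentially. L \<ge> max L0 1 \<and>
        prob {\<omega> \<in> space M. \<exists>j\<le>n. norm (increment (steps \<omega>) 0 j) \<ge> C * sqrt L} \<le> (1/2) ^ k"
      by (intro eventually_conj eventually_ge_at_top past_negligible C) simp
    then have "\<exists>L. L \<ge> max L0 1 \<and>
        prob {\<omega> \<in> space M. \<exists>j\<le>n. norm (increment (steps \<omega>) 0 j) \<ge> C * sqrt L} \<le> (1/2) ^ k"
      by (intro eventually_happens'[OF sequentially_bot])
    then show ?thesis
      unfolding len_def by (rule someI_ex)
  qed
  define start where "start = rec_nat 0 (\<lambda>k n. n + m * len k n)"
  define l where "l k = len k (start k)" for k
  have start_Suc: "start (Suc k) = start k + m * l k" for k
    by (simp add: start_def l_def)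
  have l: "l k \<ge> L0" "l k \<ge> 1" for k
    using len[of k "start k"] by (simp_all add: l_def)
  have start_less: "start k < start (Suc k)" for k
    using m l(2)[of k] by (simp add: start_Suc)
  then have strict: "strict_mono start"
    by (rule strict_mono_Suc_iff[THEN iffD2, rule_format])
  define P where "P k f \<longleftrightarrow> (\<forall>i<m. \<forall>j\<le>l k.
      norm (increment f (start k) (i * l k + j) - sqrt (l k) *\<^sub>R (\<rho> *\<^sub>R u i)) \<le> C * sqrt (l k))"
    for k and f :: "nat \<Rightarrow> 'e"
  define bad where "bad k = {\<omega> \<in> space M. \<exists>j\<le>start k. norm (increment (steps \<omega>) 0 j) \<ge> C * sqrt (l k)}" for k
  have "indep_events (\<lambda>k. {\<omega> \<in> space M. P k (steps \<omega>)}) UNIV"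
  proof (rule indep_events_blocks[where K = "\<lambda>k. {start k..<start (Suc k)}"])
    show "disjoint_family_on (\<lambda>k. {start k..<start (Suc k)}) UNIV"
      unfolding disjoint_family_on_def
    proof (intro ballI impI)
      have *: "{start i..<start (Suc i)} \<inter> {start j..<start (Suc j)} = {}" if "i < j" for i j
        using strict_mono_less_eq[OF strict, of "Suc i" j] that by auto
      fix i j :: nat assume "i \<noteq> j"
      then show "{start i..<start (Suc i)} \<inter> {start j..<start (Suc j)} = {}"
        using *[of i j] *[of j i] by (cases "i < j") auto
    qed
    show "Measurable.pred (Pi\<^sub>M UNIV (\<lambda>_. borel)) (P k)" for k
      unfolding P_def by measurable
  next
    fix k and f g :: "nat \<Rightarrow> 'e"
    assume eq: "\<And>i. i \<in> {start k..<start (Suc k)} \<Longrightarrow> f i = g i" and "P k f"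
    have "increment f (start k) (i * l k + j) = increment g (start k) (i * l k + j)"
      if "i < m" "j \<le> l k" for i j
    proof (intro increment_cong eq)
      fix r assume "start k \<le> r" "r < start k + (i * l k + j)"
      moreover have "Suc i * l k \<le> m * l k"
        using that by (intro mult_le_mono1) auto
      ultimately show "r \<in> {start k..<start (Suc k)}"
        using that by (simp add: start_Suc)
    qed
    then show "P k g"
      using \<open>P k f\<close> by (simp add: P_def)
  qed
  then have often: "AE \<omega> in M. \<exists>\<^sub>\<infinity>k. \<omega> \<in> {\<omega> \<in> space M. P k (steps \<omega>)}"
    by (rule AE_infinitely_often[OF _ q]) (use L0 l in \<open>simp add: P_def\<close>)
  have "AE \<omega> in M. \<forall>\<^sub>F k in sequentially. \<omega> \<in> space M - bad k"
  proof (rule borel_cantelli_AE1)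
    show "bad k \<in> events" for k
      unfolding bad_def by measurable
    show "summable (\<lambda>k. prob (bad k))"
    proof (rule summable_comparison_test')
      show "summable (\<lambda>k. (1/2 :: real) ^ k)"
        by (rule summable_geometric) simp
      show "norm (prob (bad k)) \<le> (1/2) ^ k" if "k \<ge> 0" for k
        using len[of k "start k"] by (simp add: bad_def l_def)
    qed
  qed (simp add: less_top[symmetric])
  with often show ?thesis
  proof eventually_elim
    case (elim \<omega>)
    then have *: "\<exists>\<^sub>\<infinity>k. P k (steps \<omega>) \<and> \<omega> \<notin> bad k \<and> \<omega> \<in> space M"
      by (auto simp: cofinite_eq_sequentially elim: frequently_rev_mp eventually_mono)
    show ?case
      unfolding INFM_nat_le
    proof
      fix n0
      obtain k where k: "k \<ge> n0" "P k (steps \<omega>)" "\<omega> \<notin> bad k" "\<omega> \<in> space M"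
        using * unfolding INFM_nat_le by blast
      define R where "R = \<rho> * sqrt (l k)"
      have R: "R > 0" "C * sqrt (l k) = \<epsilon> * R" "sqrt (l k) *\<^sub>R (\<rho> *\<^sub>R x) = R *\<^sub>R x" for x :: 'e
        using \<rho> l(2)[of k] by (auto simp: R_def mult.commute)
      have "hausdorff_distance ((\<lambda>x. inverse (diameter (H \<omega> (start (Suc k)))) *\<^sub>R x) ` H \<omega> (start (Suc k))) K
          \<le> 9 * \<epsilon>"
        unfolding H_def start_Suc
      proof (rule block_hull_close[OF K net u(2) \<epsilon>(1,2) R(1)])
        show "norm (increment (steps \<omega>) 0 j) \<le> \<epsilon> * R" if "j \<le> start k" for j
        proof (rule ccontr)
          assume "\<not> norm (increment (steps \<omega>) 0 j) \<le> \<epsilon> * R"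
          then have "C * sqrt (l k) \<le> norm (increment (steps \<omega>) 0 j)"
            using R(2) by simp
          then show False
            using k(3,4) that by (auto simp: bad_def)
        qed
        show "norm (increment (steps \<omega>) (start k) (i * l k + j) - R *\<^sub>R u i) \<le> \<epsilon> * R"
          if "i < m" "j \<le> l k" for i j
          using k(2) that unfolding P_def R(2,3) by blast
      qed
      moreover have "start (Suc k) \<ge> n0"
        using k(1) strict_mono_imp_increasing[OF strict, of "Suc k"] by simp
      ultimately show "\<exists>n\<ge>n0. hausdorff_distance
          ((\<lambda>x. inverse (diameter (H \<omega> n)) *\<^sub>R x) ` H \<omega> n) K \<le> e"
        using \<epsilon>(3) by (meson order_trans)
    qed
  qed
qed

end

section \<open>The planar walk\<close>

lemma positive_definite_lower_bound:
  fixes A :: "real^'n^'n"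
  assumes "positive_definite A"
  obtains v where "v > 0" "\<And>x. v * (norm x)\<^sup>2 \<le> x \<bullet> (A *v x)"
proof -
  obtain z :: "real^'n" where "norm z = 1"
    using vector_choose_size[of 1] by auto
  then have "sphere (0 :: real^'n) 1 \<noteq> {}"
    by auto
  moreover have "continuous_on (sphere 0 1) (\<lambda>x. x \<bullet> (A *v x))"
    by (intro continuous_intros linear_continuous_on matrix_vector_mul_bounded_linear)
  ultimately obtain y where y: "y \<in> sphere 0 1" "\<And>x. x \<in> sphere 0 1 \<Longrightarrow> y \<bullet> (A *v y) \<le> x \<bullet> (A *v x)"
    using continuous_attains_inf[OF compact_sphere] by blast
  have "y \<noteq> 0"
    using y(1) by auto
  then have pos: "y \<bullet> (A *v y) > 0"
    using assms by (simp add: positive_definite_def)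
  have "(y \<bullet> (A *v y)) * (norm x)\<^sup>2 \<le> x \<bullet> (A *v x)" for x
  proof (cases "x = 0")
    case False
    define z where "z = x /\<^sub>R norm x"
    have z: "z \<in> sphere 0 1" "x = norm x *\<^sub>R z"
      using False by (auto simp: z_def)
    have "x \<bullet> (A *v x) = (norm x)\<^sup>2 * (z \<bullet> (A *v z))"
      by (subst (1 2) z(2)) (simp add: matrix_vector_mult_scaleR power2_eq_square)
    then show ?thesis
      using mult_left_mono[OF y(2)[OF z(1)], of "(norm x)\<^sup>2"] by (simp add: mult.commute)
  qed simp
  with pos show ?thesis
    by (rule that)
qed

lemma outer_square_quadratic_form: "\<theta> \<bullet> (outer_square z *v \<theta>) = (\<theta> \<bullet> z)\<^sup>2"
proof -
  have "outer_square z $ i $ j = z $ i * z $ j" for i j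
    by (simp add: outer_square_def matrix_matrix_mult_def columnvector_def transpose_def)
  then show ?thesis
    by (simp add: inner_vec_def matrix_vector_mult_def power2_eq_square sum_product
        sum_distrib_left mult_ac)
qed

text \<open>Integrability of the matrix is automatic: otherwise the integral would be the zero matrix, which is
not positive definite.\<close>
lemma second_moment_quadratic_form:
  fixes Z :: "'o \<Rightarrow> real^'n"
  assumes "positive_definite (second_moment_matrix M Z)"
  shows "\<theta> \<bullet> (second_moment_matrix M Z *v \<theta>) = (\<integral>\<omega>. (\<theta> \<bullet> Z \<omega>)\<^sup>2 \<partial>M)"
proof -
  have integrable: "integrable M (\<lambda>\<omega>. outer_square (Z \<omega>))"
  proof (rule ccontr)
    assume "\<not> integrable M (\<lambda>\<omega>. outer_square (Z \<omega>))"
    then have "second_moment_matrix M Z = 0"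
      by (simp add: second_moment_matrix_def not_integrable_integral_eq)
    moreover obtain z :: "real^'n" where "norm z = 1"
      using vector_choose_size[of 1] by auto
    ultimately show False
      using assms by (auto simp: positive_definite_def)
  qed
  have "linear (\<lambda>A :: real^'n^'n. \<theta> \<bullet> (A *v \<theta>))"
    by (rule linearI)
       (simp_all add: matrix_vector_mult_add_rdistrib inner_add_right scaleR_matrix_vector_assoc[symmetric])
  then have "bounded_linear (\<lambda>A :: real^'n^'n. \<theta> \<bullet> (A *v \<theta>))"
    by (simp add: linear_conv_bounded_linear)
  from integral_bounded_linear[OF this integrable] show ?thesis
    by (simp add: second_moment_matrix_def outer_square_quadratic_form)
qed

lemma liminf_eq_0I:
  fixes x :: "nat \<Rightarrow> real"
  assumes "\<And>n. 0 \<le> x n" and "\<And>r. \<exists>\<^sub>\<infinity>n. x n \<le> inverse (real (Suc r))"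
  shows "liminf (\<lambda>n. ereal (x n)) = 0"
proof (rule antisym)
  show "liminf (\<lambda>n. ereal (x n)) \<le> 0"
  proof (rule ccontr)
    assume "\<not> liminf (\<lambda>n. ereal (x n)) \<le> 0"
    then obtain c where c: "0 < ereal c" "ereal c < liminf (\<lambda>n. ereal (x n))"
      using ereal_dense2[of 0 "liminf (\<lambda>n. ereal (x n))"] by (auto simp: not_le)
    obtain r where "inverse (real (Suc r)) < c"
      using c reals_Archimedean by auto
    moreover have "\<forall>\<^sub>F n in sequentially. c < x n"
      using less_LiminfD[OF c(2)] by simp
    ultimately have "\<forall>\<^sub>F n in sequentially. \<not> x n \<le> inverse (real (Suc r))"
      by (auto elim: eventually_mono)
    with assms(2)[of r] show False
      by (simp add: cofinite_eq_sequentially frequently_def)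
  qed
  show "0 \<le> liminf (\<lambda>n. ereal (x n))"
    by (rule Liminf_bounded) (use assms in simp)
qed

theorem theorem1p5:
  fixes M :: "'o measure"
    and Z :: "'o \<Rightarrow> real^2"
    and X :: "nat \<Rightarrow> 'o \<Rightarrow> real^2"
    and K :: "(real^2) set"
  assumes "prob_space M"
    and "Z \<in> borel_measurable M"
    and "prob_space.indep_vars M (\<lambda>_. borel) X {1..}"
    and "\<And>k. k \<ge> 1 \<Longrightarrow> distr M borel (X k) = distr M borel Z"
    and "integrable M (\<lambda>\<omega>. (norm (Z \<omega>))\<^sup>2)"
    and "positive_definite (second_moment_matrix M Z)"
    and "integral\<^sup>L M Z = 0"
    and "compact K" and "convex K" and "0 \<in> K" and "diameter K = 1"
  shows "AE \<omega> in M.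
    liminf (\<lambda>n. ereal (hausdorff_distance (scaled_hull X n \<omega>) K)) = 0"
proof -
  interpret prob_space M
    by fact
  note [measurable] = assms(2)
  define Y where "Y i = X (Suc i)" for i
  obtain v where v: "v > 0" "\<And>\<theta>. v * (norm \<theta>)\<^sup>2 \<le> \<theta> \<bullet> (second_moment_matrix M Z *v \<theta>)"
    using positive_definite_lower_bound[OF assms(6)] by blast
  have X_meas [measurable]: "X k \<in> borel_measurable M" if "k \<ge> 1" for k
    using assms(3) that by (auto simp: indep_vars_def2)
  have Y_meas [measurable]: "Y i \<in> borel_measurable M" for i
    using X_meas by (simp add: Y_def)
  have distr_Y: "distr M borel (Y i) = distr M borel Z" for i
    using assms(4) by (simp add: Y_def)
  have integrable_Y_iff: "integrable M (\<lambda>\<omega>. g (Y 0 \<omega>)) \<longleftrightarrow> integrable M (\<lambda>\<omega>. g (Z \<omega>))"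
    and integral_Y: "(\<integral>\<omega>. g (Y 0 \<omega>) \<partial>M) = (\<integral>\<omega>. g (Z \<omega>) \<partial>M)"
    if "g \<in> borel_measurable borel" for g :: "real^2 \<Rightarrow> 'b::{banach, second_countable_topology}"
    using integrable_distr_eq[of "Y 0" M borel g] integrable_distr_eq[of Z M borel g]
      integral_distr[of "Y 0" M borel g] integral_distr[of Z M borel g] that
    by (simp_all add: distr_Y)
  interpret iid_walk M Y v
  proof
    have "indep_vars (\<lambda>j. Pi\<^sub>M {Suc j} (\<lambda>_. borel)) (\<lambda>j \<omega>. restrict (\<lambda>i. X i \<omega>) {Suc j}) UNIV"
      by (rule indep_vars_restrict[OF assms(3)]) (auto simp: disjoint_family_on_def)
    then have "indep_vars (\<lambda>_. borel) (\<lambda>j \<omega>. (restrict (\<lambda>i. X i \<omega>) {Suc j}) (Suc j)) UNIV"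
      by (rule indep_vars_compose2[where Y = "\<lambda>j f. f (Suc j)"]) auto
    then show "indep_vars (\<lambda>_. borel) Y UNIV"
      by (simp add: Y_def[abs_def])
    show "distr M borel (Y i) = distr M borel (Y 0)" for i
      by (simp only: distr_Y)
    show "integrable M (\<lambda>\<omega>. (norm (Y 0 \<omega>))\<^sup>2)"
      using assms(5) by (subst integrable_Y_iff) auto
    show "expectation (Y 0) = 0"
      using integral_Y[of "\<lambda>y. y"] assms(7) by simp
    show "v * (norm \<theta>)\<^sup>2 \<le> expectation (\<lambda>\<omega>. (\<theta> \<bullet> Y 0 \<omega>)\<^sup>2)" for \<theta>
      using v(2)[of \<theta>] integral_Y[of "\<lambda>y. (\<theta> \<bullet> y)\<^sup>2"]
      by (simp add: second_moment_quadratic_form[OF assms(6)])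
  qed (rule v(1))
  have hull: "walk_hull X n \<omega> = convex hull ((\<lambda>k. increment (steps \<omega>) 0 k) ` {0..n})" for n \<omega>
  proof -
    have "walk X k \<omega> = increment (steps \<omega>) 0 k" for k
      by (simp add: walk_def increment_def Y_def sum.atLeast1_atMost_eq)
    then show ?thesis
      by (simp add: walk_hull_def)
  qed
  have "AE \<omega> in M. \<exists>\<^sub>\<infinity>n. hausdorff_distance (scaled_hull X n \<omega>) K \<le> inverse (real (Suc r))" for r
    unfolding scaled_hull_def hull_diam_def hull
    by (rule infinitely_often_close) (use assms in simp_all)
  then have "AE \<omega> in M. \<forall>r. \<exists>\<^sub>\<infinity>n. hausdorff_distance (scaled_hull X n \<omega>) K \<le> inverse (real (Suc r))"
    by (subst AE_all_countable) blast
  then show ?thesis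
  proof eventually_elim
    case (elim \<omega>)
    have "0 \<le> hausdorff_distance (scaled_hull X n \<omega>) K" for n
    proof (rule hausdorff_distance_nonneg)
      have "compact (walk_hull X n \<omega>)"
        unfolding walk_hull_def by (intro finite_imp_compact_convex_hull) simp
      then show "bounded (scaled_hull X n \<omega>)"
        unfolding scaled_hull_def by (intro bounded_scaling compact_imp_bounded)
      show "bounded K" "K \<noteq> {}"
        using assms by (auto intro: compact_imp_bounded)
      show "scaled_hull X n \<omega> \<noteq> {}"
        by (simp add: scaled_hull_def walk_hull_def)
    qed
    with elim show ?case
      by (intro liminf_eq_0I) auto
  qed
qed

end
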